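(* Let $X$ be a reflexive real Banach space, let $\{L_n\}$ be a family (sequence) of selfdual Lagrangians on $X\times X^*$, and let $L$ be a Lagrangian on $X\times X^*$. The following statements are equivalent: 1. $\{L_n\}$ Mosco-converges to $L$. 2. $L$ is selfdual and $\{L_n\}$ $\Gamma$-converges to $L$. 3. $L$ is selfdual and for any $(u,u^* )\in X\times X^*$ there exists a sequence $(u_n,u_n^* )$ converging strongly to $(u,u^* )$ in $X\times X^*$ such that $\limsup_n L_n(u_n,u_n^* )\le L(u,u^* )$.
   Context: A Lagrangian on $X\times X^*$ is a function $L:X\times X^*\to\mathbb{R}\cup\{+\infty\}$ on phase space. A selfdual Lagrangian on $X\times X^*$ is a convex lower semicontinuous function $L:X\times X^*\to\mathbb{R}\cup\{+\infty\}$ with $L^*(u^*,u)=L(u,u^* )$ for all $(u,u^* )\in X\times X^*$, where $L^*(u^*,u)=\sup\{\langle v,u^*\rangle+\langle u,v^*\rangle-L(v,v^* ):(v,v^* )\in X\times X^*\}$. For functionals $F_n,F$ on a reflexive Banach space $Y$, $\{F_n\}$ $\Gamma$-converges (resp. Mosco-converges) to $F$ if: (1) whenever $y_n\to y$ strongly (resp. $y_n\rightharpoonup y$ weakly) in $Y$, $F(y)\le\liminf_nF_n(y_n)$; and (2) for every $y\in Y$ there is a sequence $y_n\to y$ strongly in $Y$ with $\lim_nF_n(y_n)=F(y)$. This is applied with $Y=X\times X^*$.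
   Formalization: L is additionally assumed not to be identically +∞; otherwise 1 ⇒ 2 fails, e.g. on ℝ×ℝ with the selfdual L_n(x,p)=np if x=n and +∞ otherwise, which Mosco-converge to the constant +∞, which is not selfdual. *)

theory Defs
  imports "HOL-Analysis.Analysis"
begin

text \<open>
  The dual \<open>X\<^sup>*\<close> of a real normed space \<open>X\<close> is the type \<open>'a \<Rightarrow>\<^sub>L real\<close> of bounded linear functionals
  with the operator norm. Phase space \<open>X \<times> X\<^sup>*\<close> is the product type; its norm is the Euclidean
  combination of the two norms, so strong convergence is convergence in both components.
  Functions into \<open>\<real> \<union> {+\<infinity>}\<close> are functions into \<open>ereal\<close> that never take the value \<open>-\<infinity>\<close>.
\<close>

type_synonym 'a phase = "'a \<times> ('a \<Rightarrow>\<^sub>L real)"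

text \<open>Surjectivity of the canonical embedding \<open>x \<mapsto> (f \<mapsto> f x)\<close> into the bidual.\<close>

definition reflexive_space :: "'a::real_normed_vector itself \<Rightarrow> bool" where
  "reflexive_space _ \<longleftrightarrow>
     (\<forall>\<Phi> :: ('a \<Rightarrow>\<^sub>L real) \<Rightarrow>\<^sub>L real. \<exists>x::'a. \<forall>f. blinfun_apply \<Phi> f = blinfun_apply f x)"

definition weakly_converges :: "(nat \<Rightarrow> 'b::real_normed_vector) \<Rightarrow> 'b \<Rightarrow> bool" where
  "weakly_converges y l \<longleftrightarrow>
     (\<forall>f :: 'b \<Rightarrow>\<^sub>L real. (\<lambda>n. blinfun_apply f (y n)) \<longlonglongrightarrow> blinfun_apply f l)"

definition Gamma_converges ::
    "(nat \<Rightarrow> 'b::real_normed_vector \<Rightarrow> ereal) \<Rightarrow> ('b \<Rightarrow> ereal) \<Rightarrow> bool" where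
  "Gamma_converges Fn F \<longleftrightarrow>
     (\<forall>y l. y \<longlonglongrightarrow> l \<longrightarrow> F l \<le> liminf (\<lambda>n. Fn n (y n))) \<and>
     (\<forall>l. \<exists>y. y \<longlonglongrightarrow> l \<and> (\<lambda>n. Fn n (y n)) \<longlonglongrightarrow> F l)"

definition Mosco_converges ::
    "(nat \<Rightarrow> 'b::real_normed_vector \<Rightarrow> ereal) \<Rightarrow> ('b \<Rightarrow> ereal) \<Rightarrow> bool" where
  "Mosco_converges Fn F \<longleftrightarrow>
     (\<forall>y l. weakly_converges y l \<longrightarrow> F l \<le> liminf (\<lambda>n. Fn n (y n))) \<and>
     (\<forall>l. \<exists>y. y \<longlonglongrightarrow> l \<and> (\<lambda>n. Fn n (y n)) \<longlonglongrightarrow> F l)"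

definition Lagrangian :: "('a::real_normed_vector phase \<Rightarrow> ereal) \<Rightarrow> bool" where
  "Lagrangian L \<longleftrightarrow> (\<forall>x. L x \<noteq> -\<infinity>)"

text \<open>
  Selfdual Lagrangians are automatically proper, but a Mosco limit of selfdual Lagrangians need not
  be: on \<open>\<real> \<times> \<real>\<close> the selfdual Lagrangians \<open>L\<^sub>n(x, p) = n p\<close> for \<open>x = n\<close> and \<open>+\<infinity>\<close> otherwise Mosco-converge
  to the constant \<open>+\<infinity>\<close>, whose conjugate is \<open>-\<infinity>\<close>.
\<close>

definition proper_fun :: "('b \<Rightarrow> ereal) \<Rightarrow> bool" where
  "proper_fun F \<longleftrightarrow> (\<exists>x. F x \<noteq> \<infinity>)"

text \<open>For functions that never take the value \<open>-\<infinity>\<close>, so that the sum below is never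
  \<open>\<infinity> + (-\<infinity>)\<close>.\<close>

definition convex_ereal :: "('b::real_vector \<Rightarrow> ereal) \<Rightarrow> bool" where
  "convex_ereal F \<longleftrightarrow>
     (\<forall>x y t. 0 < t \<and> t < 1 \<longrightarrow>
        F ((1 - t) *\<^sub>R x + t *\<^sub>R y) \<le> ereal (1 - t) * F x + ereal t * F y)"

definition lower_semicontinuous :: "('b::topological_space \<Rightarrow> ereal) \<Rightarrow> bool" where
  "lower_semicontinuous F \<longleftrightarrow> (\<forall>c::real. closed {x. F x \<le> ereal c})"

text \<open>The Legendre transform on phase space, where \<open>(X \<times> X\<^sup>*)\<^sup>*\<close> is identified with
  \<open>X\<^sup>* \<times> X\<close> (\<open>X\<close> being reflexive) via \<open>(p, u) \<mapsto> ((v, q) \<mapsto> p v + q u)\<close>.\<close>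

definition phase_conjugate ::
    "('a::real_normed_vector phase \<Rightarrow> ereal) \<Rightarrow> ('a \<Rightarrow>\<^sub>L real) \<Rightarrow> 'a \<Rightarrow> ereal" where
  "phase_conjugate L p u =
     (SUP (v, q) \<in> (UNIV :: 'a phase set).
        ereal (blinfun_apply p v + blinfun_apply q u) - L (v, q))"

definition selfdual_Lagrangian :: "('a::real_normed_vector phase \<Rightarrow> ereal) \<Rightarrow> bool" where
  "selfdual_Lagrangian L \<longleftrightarrow>
     Lagrangian L \<and> convex_ereal L \<and> lower_semicontinuous L \<and>
     (\<forall>u p. phase_conjugate L p u = L (u, p))"

end

theory Submission
  imports Defs "HOL-Complex_Analysis.Great_Picard"
begin

text \<open>
  Selfduality makes one of the two conditions of Mosco convergence a consequence of the other. By
  \<open>selfdual_Lagrangian_pairing_le\<close>, a value \<open>L\<^sub>n(u\<^sub>n, p\<^sub>n)\<close> is at least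
  \<open>p\<^sub>n(v\<^sub>n) + q\<^sub>n(u\<^sub>n) - L\<^sub>n(v\<^sub>n, q\<^sub>n)\<close>. If \<open>(u\<^sub>n, p\<^sub>n)\<close> converges weakly to \<open>(u, p)\<close> and \<open>(v\<^sub>n, q\<^sub>n)\<close> is a
  recovery sequence of \<open>(v, q)\<close>, the pairings converge and the limit inferior of \<open>L\<^sub>n(u\<^sub>n, p\<^sub>n)\<close> is at
  least \<open>p(v) + q(u) - L(v, q)\<close>; the supremum over \<open>(v, q)\<close> is the conjugate of \<open>L\<close> at \<open>(p, u)\<close>
  (\<open>conjugate_le_liminf_if_recovery\<close>). If \<open>L\<close> is selfdual, this is the weak liminf inequality, so that
  recovery sequences alone imply Mosco convergence. Mosco convergence implies \<open>\<Gamma>\<close>-convergence, and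
  \<open>\<Gamma>\<close>-convergence provides recovery sequences.

  It remains to see that a proper Mosco limit \<open>L\<close> is selfdual. The same inequality along a recovery
  sequence of \<open>(u, p)\<close> bounds the conjugate by \<open>L\<close>. For the converse bound
  (\<open>Mosco_limit_le_conjugate\<close>), let \<open>a\<close> be the conjugate of \<open>L\<close> at \<open>(p, u)\<close>, assumed finite, and
  \<open>y = (u, p)\<close>. If for some \<open>R\<close> and \<open>b > a\<close> the penalized functions \<open>L\<^sub>n(z) + R \<parallel>z - y\<parallel>\<close> were all at
  least \<open>b\<close> for large \<open>n\<close>, the Hahn-Banach theorem would produce affine minorants of \<open>L\<^sub>n\<close> with slopes of
  norm at most \<open>R\<close>. Through the selfduality of \<open>L\<^sub>n\<close> these slopes form a bounded sequence in phase space
  on which the values of \<open>L\<^sub>n\<close> are so small that a weak limit point contradicts the definition of \<open>a\<close>.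
  Hence along a subsequence there are points \<open>z\<^sub>k\<close> with \<open>L\<^sub>n(z\<^sub>k) + k \<parallel>z\<^sub>k - y\<parallel> < a + 1/(k+1)\<close>. The \<open>L\<^sub>n\<close>
  are bounded below by a common linear function of the norm, so \<open>z\<^sub>k\<close> tends to \<open>y\<close>, and the liminf
  inequality gives \<open>L(y) \<le> a\<close>. Thus \<open>L\<close> equals its conjugate, and convexity and lower semicontinuity
  follow.

  Two theorems of functional analysis carry this argument: the Hahn-Banach theorem, in the sandwich
  form \<open>Hahn_Banach_sandwich\<close>, and the weak sequential compactness of bounded sets in reflexive spaces,
  \<open>bounded_imp_weakly_convergent_subseq\<close>, which is derived from it.
\<close>

section \<open>The Hahn-Banach theorem in sandwich form\<close>

text \<open>
  The Hahn-Banach theorem is obtained from minimal sublinear functionals instead of extensions from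
  subspaces: every sublinear functional dominates a minimal one, and minimal ones are linear.
  Domination of a convex function \<open>f\<close> on \<open>S\<close> is built into the sublinear functional beforehand, so
  that norming functionals, separation and Fenchel duality are all instances of one statement.
\<close>

definition sublinear :: "('v::real_vector \<Rightarrow> real) \<Rightarrow> bool" where
  "sublinear q \<longleftrightarrow>
     (\<forall>x y. q (x + y) \<le> q x + q y) \<and> (\<forall>c\<ge>0. \<forall>x. q (c *\<^sub>R x) = c * q x)"

lemma sublinearI:
  assumes "\<And>x y. q (x + y) \<le> q x + q y"
    and "\<And>c x. 0 < c \<Longrightarrow> q (c *\<^sub>R x) \<le> c * q x"
    and "q 0 = 0"
  shows "sublinear q"
  unfolding sublinear_def
proof (intro conjI allI impI assms(1))
  fix c :: real and x
  assume "0 \<le> c"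
  show "q (c *\<^sub>R x) = c * q x"
  proof (cases "c = 0")
    case False
    with \<open>0 \<le> c\<close> have c: "0 < c" by simp
    have "q (inverse c *\<^sub>R (c *\<^sub>R x)) \<le> inverse c * q (c *\<^sub>R x)"
      using c by (intro assms(2)) simp
    then have "q x \<le> q (c *\<^sub>R x) / c"
      using c by (simp add: field_simps)
    then have "c * q x \<le> q (c *\<^sub>R x)"
      using c by (simp add: field_simps)
    with assms(2)[OF c, of x] show ?thesis by simp
  qed (simp add: assms(3))
qed

lemma sublinear_add: "sublinear q \<Longrightarrow> q (x + y) \<le> q x + q y"
  by (simp add: sublinear_def)

lemma sublinear_scale: "sublinear q \<Longrightarrow> 0 \<le> c \<Longrightarrow> q (c *\<^sub>R x) = c * q x"
  by (simp add: sublinear_def)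

lemma sublinear_zero: "sublinear q \<Longrightarrow> q 0 = 0"
  using sublinear_scale[of q 0 0] by simp

lemma sublinear_minus: "sublinear q \<Longrightarrow> - q (- x) \<le> q x"
  using sublinear_add[of q x "- x"] sublinear_zero[of q] by simp

lemma sublinear_norm: "0 \<le> R \<Longrightarrow> sublinear (\<lambda>x::'v::real_normed_vector. R * norm x)"
  by (rule sublinearI) (auto simp: norm_triangle_ineq mult_left_mono simp flip: distrib_left)

text \<open>
  The infimal convolution of \<open>p\<close> with the positively homogeneous hull of \<open>f\<close>,
  \<open>q x = (INF t\<ge>0. INF k\<in>S. t * f k + p (x - t *\<^sub>R k))\<close>.
  It lies below \<open>p\<close> because of \<open>t = 0\<close> and below \<open>f\<close> because of \<open>t = 1\<close> and \<open>k = x\<close>. The hypothesis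
  \<open>-p(-k) \<le> f k\<close> keeps the infimum above \<open>-p(-x)\<close>, and subadditivity is the convexity of \<open>f\<close>:
  two competitors \<open>(s, k)\<close>, \<open>(t, l)\<close> combine to \<open>(s + t, (s k + t l) / (s + t))\<close>.
\<close>

lemma sublinear_inf_convolution:
  fixes p :: "'v::real_vector \<Rightarrow> real"
  assumes p: "sublinear p" and f: "convex_on S f" and ne: "S \<noteq> {}"
    and pf: "\<And>k. k \<in> S \<Longrightarrow> - p (- k) \<le> f k"
  obtains q where "sublinear q" "\<And>x. q x \<le> p x" "\<And>k. k \<in> S \<Longrightarrow> q k \<le> f k"
proof -
  define I where "I = {0::real..} \<times> S"
  define w where "w x = (\<lambda>(t, k). t * f k + p (x - t *\<^sub>R k))" for x
  define q where "q x = (INF i\<in>I. w x i)" for x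
  obtain k0 where k0: "k0 \<in> S" using ne by blast
  have Ine: "I \<noteq> {}" using k0 by (auto simp: I_def)
  have lower: "- p (- x) \<le> w x i" if iI: "i \<in> I" for x i
  proof -
    obtain t k where i: "i = (t, k)" "0 \<le> t" "k \<in> S"
      using iI by (cases i) (auto simp: I_def)
    have "t * - p (- k) \<le> t * f k"
      using pf[OF i(3)] i(2) by (rule mult_left_mono)
    moreover have "p (- (t *\<^sub>R k)) = t * p (- k)"
      using sublinear_scale[OF p i(2), of "- k"] by simp
    moreover have "p (- (t *\<^sub>R k)) \<le> p (x - t *\<^sub>R k) + p (- x)"
      using sublinear_add[OF p, of "x - t *\<^sub>R k" "- x"] by simp
    ultimately show ?thesis by (simp add: w_def i(1))
  qed
  have bdd: "bdd_below (w x ` I)" for x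
    by (rule bdd_belowI2[where m = "- p (- x)"]) (rule lower)
  have q_le: "q x \<le> w x i" if "i \<in> I" for x i
    unfolding q_def using bdd that by (rule cINF_lower)
  have q_p: "q x \<le> p x" for x
    using q_le[of "(0, k0)" x] k0 by (simp add: I_def w_def)
  have q_f: "q k \<le> f k" if "k \<in> S" for k
    using q_le[of "(1, k)" k] that sublinear_zero[OF p] by (simp add: I_def w_def)
  have w_add: "\<exists>l\<in>I. w (x + y) l \<le> w x i + w y j" if ij: "i \<in> I" "j \<in> I" for x y i j
  proof -
    obtain s k where i: "i = (s, k)" "0 \<le> s" "k \<in> S"
      using ij by (cases i) (auto simp: I_def)
    obtain t l where j: "j = (t, l)" "0 \<le> t" "l \<in> S"
      using ij by (cases j) (auto simp: I_def)
    show ?thesis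
    proof (cases "s + t = 0")
      case True
      with i(2) j(2) have "s = 0" "t = 0" by auto
      then show ?thesis
        using sublinear_add[OF p, of x y] ij by (intro bexI[of _ i]) (auto simp: w_def i j)
    next
      case False
      with i(2) j(2) have st: "0 < s + t" by simp
      define m where "m = (s / (s + t)) *\<^sub>R k + (t / (s + t)) *\<^sub>R l"
      have one: "s / (s + t) + t / (s + t) = 1"
        using st by (simp add: add_divide_distrib[symmetric])
      have nonneg: "0 \<le> s / (s + t)" "0 \<le> t / (s + t)"
        using i(2) j(2) st by auto
      have m: "m \<in> S" "f m \<le> s / (s + t) * f k + t / (s + t) * f l"
        using convexD[OF convex_on_imp_convex[OF f] i(3) j(3) nonneg one]
          f[unfolded convex_on_def, THEN conjunct2, rule_format, OF i(3) j(3) nonneg one]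
        by (simp_all add: m_def)
      have "(s + t) * f m \<le> (s + t) * (s / (s + t) * f k + t / (s + t) * f l)"
        using m(2) st by (intro mult_left_mono) auto
      also have "\<dots> = s * f k + t * f l"
        using st by (simp only: distrib_left times_divide_eq_left times_divide_eq_right) simp
      finally have 1: "(s + t) * f m \<le> s * f k + t * f l" .
      have "(s + t) *\<^sub>R m = s *\<^sub>R k + t *\<^sub>R l"
        using st by (simp add: m_def scaleR_add_right)
      then have "p (x + y - (s + t) *\<^sub>R m) = p ((x - s *\<^sub>R k) + (y - t *\<^sub>R l))"
        by (simp add: algebra_simps)
      also have "\<dots> \<le> p (x - s *\<^sub>R k) + p (y - t *\<^sub>R l)"
        by (rule sublinear_add[OF p])
      finally show ?thesis
        using 1 m(1) st by (intro bexI[of _ "(s + t, m)"]) (auto simp: w_def i j I_def)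
    qed
  qed
  have "sublinear q"
  proof (rule sublinearI)
    fix x y
    have "q (x + y) - w x i \<le> w y j" if ij: "i \<in> I" "j \<in> I" for i j
    proof -
      obtain l where "l \<in> I" "w (x + y) l \<le> w x i + w y j"
        using w_add[OF ij] by blast
      with q_le[of l "x + y"] show ?thesis by simp
    qed
    then have "q (x + y) - w x i \<le> q y" if "i \<in> I" for i
      unfolding q_def[of y] using Ine that by (intro cINF_greatest) auto
    then have "q (x + y) - q y \<le> w x i" if "i \<in> I" for i
      using that by (simp add: algebra_simps)
    then have "q (x + y) - q y \<le> q x"
      unfolding q_def[of x] using Ine by (intro cINF_greatest) auto
    then show "q (x + y) \<le> q x + q y" by simp
  next
    fix c :: real and x
    assume c: "0 < c"
    have "q (c *\<^sub>R x) / c \<le> w x i" if iI: "i \<in> I" for i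
    proof -
      obtain t k where i: "i = (t, k)" "0 \<le> t" "k \<in> S"
        using iI by (cases i) (auto simp: I_def)
      have "p (c *\<^sub>R x - (c * t) *\<^sub>R k) = c * p (x - t *\<^sub>R k)"
        using sublinear_scale[OF p, of c "x - t *\<^sub>R k"] c by (simp add: scaleR_diff_right)
      then have "w (c *\<^sub>R x) (c * t, k) = c * w x i"
        by (simp add: w_def i algebra_simps)
      with q_le[of "(c * t, k)" "c *\<^sub>R x"] c i show ?thesis
        by (simp add: I_def field_simps)
    qed
    then have "q (c *\<^sub>R x) / c \<le> q x"
      unfolding q_def[of x] using Ine by (intro cINF_greatest) auto
    then show "q (c *\<^sub>R x) \<le> c * q x"
      using c by (simp add: field_simps)
  next
    have "0 \<le> q 0"
      unfolding q_def using Ine lower[of _ 0] sublinear_zero[OF p]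
      by (intro cINF_greatest) auto
    with q_p[of 0] sublinear_zero[OF p] show "q 0 = 0" by simp
  qed
  with q_p q_f that show ?thesis by blast
qed

text \<open>
  Zorn's lemma for the reversed pointwise order. The infimum \<open>u\<close> of a chain is finite because every
  sublinear \<open>a \<le> p\<close> satisfies \<open>-p(-x) \<le> a x\<close>; it is subadditive because of two members of a chain
  one lies below the other.
\<close>

lemma minimal_sublinear:
  fixes p :: "'v::real_vector \<Rightarrow> real"
  assumes p: "sublinear p"
  obtains m where "sublinear m" "\<And>x. m x \<le> p x"
    "\<And>q. sublinear q \<Longrightarrow> (\<And>x. q x \<le> m x) \<Longrightarrow> q = m"
proof -
  define A where "A = {q. sublinear q \<and> q \<le> p}"
  have "\<exists>m\<in>A. \<forall>a\<in>A. a \<le> m \<longrightarrow> a = m"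
  proof (rule predicate_Zorn)
    show "partial_order_on A (relation_of (\<lambda>a b. b \<le> a) A)"
      by (rule partial_order_on_relation_ofI) auto
  next
    fix C
    assume C: "C \<in> Chains (relation_of (\<lambda>a b::'v \<Rightarrow> real. b \<le> a) A)"
    show "\<exists>u\<in>A. \<forall>a\<in>C. u \<le> a"
    proof (cases "C = {}")
      case True
      then show ?thesis using p by (intro bexI[of _ p]) (auto simp: A_def)
    next
      case False
      have CA: "a \<in> A" if "a \<in> C" for a
        using C that by (auto simp: Chains_def relation_of_def)
      have tot: "a \<le> b \<or> b \<le> a" if "a \<in> C" "b \<in> C" for a b
        using C that by (auto simp: Chains_def relation_of_def)
      have sub: "sublinear a" and ap: "a x \<le> p x" if "a \<in> C" for a x
        using CA[OF that] by (auto simp: A_def le_fun_def)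
      define u where "u x = (INF a\<in>C. a x)" for x
      have lower: "- p (- x) \<le> a x" if "a \<in> C" for a x
        using sublinear_minus[OF sub[OF that], of x] ap[OF that, of "- x"] by simp
      have u_le: "u x \<le> a x" if "a \<in> C" for a x
        unfolding u_def
        by (rule cINF_lower[OF bdd_belowI2[where m = "- p (- x)"] that]) (rule lower)
      have u_ge: "c \<le> u x" if "\<And>a. a \<in> C \<Longrightarrow> c \<le> a x" for c x
        unfolding u_def using False that by (intro cINF_greatest)
      have "sublinear u"
      proof (rule sublinearI)
        fix x y
        have "u (x + y) \<le> a x + b y" if ab: "a \<in> C" "b \<in> C" for a b
          using tot[OF ab]
        proof
          assume "a \<le> b"
          then have "a y \<le> b y" by (simp add: le_fun_def)
          with u_le[OF ab(1), of "x + y"] sublinear_add[OF sub[OF ab(1)], of x y]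
          show ?thesis by linarith
        next
          assume "b \<le> a"
          then have "b x \<le> a x" by (simp add: le_fun_def)
          with u_le[OF ab(2), of "x + y"] sublinear_add[OF sub[OF ab(2)], of x y]
          show ?thesis by linarith
        qed
        then have "u (x + y) - a x \<le> u y" if "a \<in> C" for a
          using that by (intro u_ge) (force simp: algebra_simps)
        then have "u (x + y) - u y \<le> u x"
          by (intro u_ge) (simp add: algebra_simps)
        then show "u (x + y) \<le> u x + u y" by simp
      next
        fix c :: real and x
        assume c: "0 < c"
        have "u (c *\<^sub>R x) / c \<le> a x" if "a \<in> C" for a
          using u_le[OF that, of "c *\<^sub>R x"] sublinear_scale[OF sub[OF that], of c x] c
          by (simp add: field_simps)
        then have "u (c *\<^sub>R x) / c \<le> u x" by (rule u_ge)
        then show "u (c *\<^sub>R x) \<le> c * u x" using c by (simp add: field_simps)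
      next
        obtain a where a: "a \<in> C" using False by blast
        have "0 \<le> u 0"
          by (rule u_ge) (simp add: sublinear_zero sub)
        with u_le[OF a, of 0] sublinear_zero[OF sub[OF a]] show "u 0 = 0" by simp
      qed
      moreover have "u \<le> p"
        unfolding le_fun_def using False by (meson all_not_in_conv u_le ap order_trans)
      ultimately show ?thesis
        using u_le by (intro bexI[of _ u]) (auto simp: A_def le_fun_def)
    qed
  qed
  then obtain m where m: "sublinear m" "m \<le> p" "\<And>a. sublinear a \<Longrightarrow> a \<le> p \<Longrightarrow> a \<le> m \<Longrightarrow> a = m"
    by (auto simp: A_def)
  show thesis
  proof
    show "q = m" if "sublinear q" "\<And>x. q x \<le> m x" for q
    proof (rule m(3))
      show "q \<le> m" using that(2) by (simp add: le_fun_def)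
      with m(2) show "q \<le> p" by (rule order_trans[rotated])
    qed (rule that(1))
  qed (use m in \<open>auto simp: le_fun_def\<close>)
qed

text \<open>
  A minimal sublinear \<open>m\<close> is odd, hence linear: convolving \<open>m\<close> with the constant \<open>- m x\<close> on \<open>{- x}\<close>
  gives a sublinear functional below \<open>m\<close>, which is \<open>m\<close> by minimality, and its value at \<open>- x\<close> is at most
  \<open>- m x\<close>.
\<close>

theorem Hahn_Banach_sandwich:
  fixes p :: "'v::real_vector \<Rightarrow> real"
  assumes "sublinear p" "convex_on S f" "S \<noteq> {}"
    and "\<And>k. k \<in> S \<Longrightarrow> - p (- k) \<le> f k"
  obtains g where "linear g" "\<And>x. g x \<le> p x" "\<And>k. k \<in> S \<Longrightarrow> g k \<le> f k"
proof -
  obtain q where q: "sublinear q" "\<And>x. q x \<le> p x" "\<And>k. k \<in> S \<Longrightarrow> q k \<le> f k"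
    using sublinear_inf_convolution[OF assms] by blast
  obtain m where m: "sublinear m" "\<And>x. m x \<le> q x"
    "\<And>r. sublinear r \<Longrightarrow> (\<And>x. r x \<le> m x) \<Longrightarrow> r = m"
    using minimal_sublinear[OF q(1)] by blast
  have odd: "m (- x) = - m x" for x
  proof -
    have "convex_on {- x} (\<lambda>_. - m x)"
      by (simp add: convex_on_const)
    then obtain r where "sublinear r" "\<And>y. r y \<le> m y" "r (- x) \<le> - m x"
      using sublinear_inf_convolution[OF m(1), of "{- x}" "\<lambda>_. - m x"] by auto
    with m(3) have "m (- x) \<le> - m x" by metis
    with sublinear_minus[OF m(1), of x] show ?thesis by simp
  qed
  have add: "m (x + y) = m x + m y" for x y
    using sublinear_add[OF m(1), of x y] sublinear_add[OF m(1), of "x + y" "- y"] odd[of y] by simp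
  have scale: "m (c *\<^sub>R x) = c *\<^sub>R m x" for c x
  proof (cases "0 \<le> c")
    case True
    then show ?thesis by (simp add: sublinear_scale[OF m(1)])
  next
    case False
    then have "m ((- c) *\<^sub>R x) = (- c) * m x"
      by (intro sublinear_scale[OF m(1)]) simp
    then show ?thesis using odd[of "c *\<^sub>R x"] by simp
  qed
  have "linear m" using add scale by (rule linearI)
  then show ?thesis
    by (rule that[OF _ order_trans[OF m(2) q(2)] order_trans[OF m(2) q(3)]])
qed

corollary blinfun_sandwich:
  fixes f :: "'v::real_normed_vector \<Rightarrow> real"
  assumes R: "0 \<le> R" and "convex_on S f" "S \<noteq> {}"
    and "\<And>k. k \<in> S \<Longrightarrow> - (R * norm k) \<le> f k"
  obtains g :: "'v \<Rightarrow>\<^sub>L real" where "norm g \<le> R" "\<And>k. k \<in> S \<Longrightarrow> blinfun_apply g k \<le> f k"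
proof -
  obtain g where g: "linear g" "\<And>x. g x \<le> R * norm x" "\<And>k. k \<in> S \<Longrightarrow> g k \<le> f k"
    using Hahn_Banach_sandwich[OF sublinear_norm[OF R] assms(2,3)] assms(4) by auto
  have abs: "norm (g x) \<le> norm x * R" for x
    using g(2)[of x] g(2)[of "- x"] linear_neg[OF g(1), of x] by (simp add: mult.commute)
  have bl: "bounded_linear g"
    by (rule bounded_linear_intro[where K = R]) (use g(1) abs in \<open>simp_all add: linear_add linear_scale\<close>)
  show thesis
  proof
    show "norm (Blinfun g) \<le> R"
      using abs R by (intro norm_blinfun_bound) (auto simp: bounded_linear_Blinfun_apply[OF bl] mult.commute)
  qed (simp add: bounded_linear_Blinfun_apply[OF bl] g(3))
qed

corollary norming_functional:
  fixes x :: "'v::real_normed_vector"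
  obtains g :: "'v \<Rightarrow>\<^sub>L real" where "norm g \<le> 1" "blinfun_apply g x = norm x"
proof -
  have "convex_on {- x} (\<lambda>_. - norm x)"
    by (simp add: convex_on_const)
  then obtain g :: "'v \<Rightarrow>\<^sub>L real" where g: "norm g \<le> 1" "blinfun_apply g (- x) \<le> - norm x"
    using blinfun_sandwich[of 1 "{- x}" "\<lambda>_. - norm x"] by auto
  have "\<bar>blinfun_apply g x\<bar> \<le> norm x"
    using norm_blinfun[of g x] g(1) mult_right_mono[OF g(1), of "norm x"] by simp
  with g that[of g] show thesis by (simp add: blinfun.minus_right)
qed

text \<open>
  The sandwich on the translate \<open>M - x\<close>, on which the norm is at least the distance \<open>d\<close> from \<open>x\<close> to \<open>M\<close>,
  with the constant function \<open>-d\<close>. The functional found is bounded above on the subspace \<open>M\<close>, so it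
  vanishes there.
\<close>

corollary functional_separating_subspace:
  fixes x :: "'v::real_normed_vector"
  assumes M: "subspace M" and x: "x \<notin> closure M"
  obtains g :: "'v \<Rightarrow>\<^sub>L real" where "\<And>m. m \<in> M \<Longrightarrow> blinfun_apply g m = 0" "blinfun_apply g x \<noteq> 0"
proof -
  obtain d where d: "0 < d" "\<And>m. m \<in> M \<Longrightarrow> d \<le> dist m x"
    using x by (auto simp: closure_approachable not_less)
  have "convex ((\<lambda>m. m - x) ` M)"
    using subspace_imp_convex[OF M] by (simp add: convex_translation_subtract_eq)
  then have "convex_on ((\<lambda>m. m - x) ` M) (\<lambda>_. - d)"
    by (simp add: convex_on_const)
  moreover have "(\<lambda>m. m - x) ` M \<noteq> {}" using subspace_0[OF M] by blast
  moreover have "- (1 * norm k) \<le> - d" if "k \<in> (\<lambda>m. m - x) ` M" for k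
    using that d(2) by (auto simp: dist_norm)
  ultimately obtain g :: "'v \<Rightarrow>\<^sub>L real" where
    "\<And>k. k \<in> (\<lambda>m. m - x) ` M \<Longrightarrow> blinfun_apply g k \<le> - d"
    using blinfun_sandwich[of 1 "(\<lambda>m. m - x) ` M" "\<lambda>_. - d"] zero_le_one by metis
  then have "blinfun_apply g (m - x) \<le> - d" if "m \<in> M" for m
    using that by blast
  then have g: "blinfun_apply g m \<le> blinfun_apply g x - d" if "m \<in> M" for m
    using that by (force simp: blinfun.diff_right)
  show thesis
  proof
    show "blinfun_apply g m = 0" if "m \<in> M" for m
    proof (rule ccontr)
      assume "blinfun_apply g m \<noteq> 0"
      \<comment> \<open>The multiple of m at which g would take the value g x.\<close>
      with g[OF subspace_scale[OF M that], of "blinfun_apply g x / blinfun_apply g m"] d(1)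
      show False by (simp add: blinfun.scaleR_right)
    qed
    show "blinfun_apply g x \<noteq> 0"
      using g[OF subspace_0[OF M]] d(1) by (simp add: blinfun.zero_right)
  qed
qed

section \<open>Bounded and weakly convergent sequences\<close>

text \<open>
  The uniform boundedness principle: by Baire's theorem one of the closed sets
  \<open>{x. \<forall>n. \<bar>f n x\<bar> \<le> k}\<close> contains a ball, and differences of points of that ball reach every direction.
\<close>

theorem pointwise_bounded_imp_norm_bounded:
  fixes f :: "nat \<Rightarrow> ('b::banach \<Rightarrow>\<^sub>L real)"
  assumes "\<And>x. \<exists>K. \<forall>n. \<bar>blinfun_apply (f n) x\<bar> \<le> K"
  obtains K where "0 \<le> K" "\<And>n. norm (f n) \<le> K"
proof -
  define A where "A k = {x. \<forall>n. \<bar>blinfun_apply (f n) x\<bar> \<le> real k}" for k :: nat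
  have closed: "closed (A k)" for k
    unfolding A_def by (intro closed_Collect_all closed_Collect_le continuous_intros)
  have "(\<Union>k. A k) = UNIV"
  proof safe
    fix x
    obtain K where K: "\<And>n. \<bar>blinfun_apply (f n) x\<bar> \<le> K" using assms by blast
    obtain k :: nat where "K \<le> real k" using real_arch_simple by blast
    then have "x \<in> A k" using order_trans[OF K] by (simp add: A_def)
    then show "x \<in> (\<Union>k. A k)" by blast
  qed simp
  then have "\<not> (\<forall>k. interior (A k) = {})"
    using Baire_category_alt[of "euclidean :: 'b topology" "range A"] closed
    by (force simp: completely_metrizable_space_euclidean)
  then obtain k z where "z \<in> interior (A k)" by blast
  then obtain e where e: "0 < e" "ball z e \<subseteq> A k"
    by (auto simp: mem_interior)
  define K where "K = 4 * real k / e"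
  have "norm (f n) \<le> K" for n
  proof (rule norm_blinfun_bound)
    show "0 \<le> K" using e by (simp add: K_def)
    fix x
    show "norm (blinfun_apply (f n) x) \<le> K * norm x"
    proof (cases "x = 0")
      case False
      \<comment> \<open>Scales x to half the radius of the ball.\<close>
      define c where "c = e / (2 * norm x)"
      have c: "0 < c" "norm (c *\<^sub>R x) < e"
        using False e(1) by (auto simp: c_def)
      have "z + c *\<^sub>R x \<in> A k" "z \<in> A k"
        using e c by (auto simp: subset_eq dist_norm)
      then have "\<bar>blinfun_apply (f n) (z + c *\<^sub>R x)\<bar> \<le> k" "\<bar>blinfun_apply (f n) z\<bar> \<le> k"
        by (auto simp: A_def)
      then have "\<bar>c * blinfun_apply (f n) x\<bar> \<le> 2 * k"
        by (simp add: blinfun.add_right blinfun.scaleR_right)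
      then have "c * \<bar>blinfun_apply (f n) x\<bar> \<le> 2 * k"
        using c by (simp add: abs_mult)
      then show ?thesis
        using False e(1) by (simp add: c_def K_def field_simps)
    qed (simp add: blinfun.zero_right)
  qed
  moreover have "0 \<le> K" using e by (simp add: K_def)
  ultimately show thesis using that by blast
qed

text \<open>
  A pairing of a weakly\<open>*\<close> convergent with a strongly convergent sequence converges, because the former
  is bounded by the uniform boundedness principle.
\<close>

lemma pointwise_convergent_pairing:
  fixes f :: "nat \<Rightarrow> ('b::banach \<Rightarrow>\<^sub>L real)"
  assumes f: "\<And>x. (\<lambda>n. blinfun_apply (f n) x) \<longlonglongrightarrow> blinfun_apply g x" and y: "y \<longlonglongrightarrow> z"
  shows "(\<lambda>n. blinfun_apply (f n) (y n)) \<longlonglongrightarrow> blinfun_apply g z"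
proof -
  have "\<exists>K. \<forall>n. \<bar>blinfun_apply (f n) x\<bar> \<le> K" for x
    using convergent_imp_Bseq[OF convergentI[OF f[of x]]] by (auto simp: Bseq_def)
  then obtain K where K: "0 \<le> K" "\<And>n. norm (f n) \<le> K"
    using pointwise_bounded_imp_norm_bounded by metis
  have "(\<lambda>n. K * norm (y n - z)) \<longlonglongrightarrow> K * 0"
    using y by (intro tendsto_intros) (simp add: LIM_zero tendsto_norm_zero)
  then have "(\<lambda>n. blinfun_apply (f n) (y n - z)) \<longlonglongrightarrow> 0"
  proof (rule Lim_null_comparison[rotated, OF tendsto_eq_rhs])
    show "\<forall>\<^sub>F n in sequentially. norm (blinfun_apply (f n) (y n - z)) \<le> K * norm (y n - z)"
      by (intro always_eventually allI order_trans[OF norm_blinfun] mult_right_mono K(2)) simp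
  qed simp
  from tendsto_add[OF this f[of z]] show ?thesis
    by (simp add: blinfun.diff_right)
qed

definition evaluation :: "'b::real_normed_vector \<Rightarrow> ('b \<Rightarrow>\<^sub>L real) \<Rightarrow>\<^sub>L real" where
  "evaluation x = Blinfun (\<lambda>f. blinfun_apply f x)"

lemma evaluation_apply [simp]: "blinfun_apply (evaluation x) f = blinfun_apply f x"
  unfolding evaluation_def
  by (simp add: bounded_linear_Blinfun_apply[OF blinfun.bounded_linear_left])

text \<open>
  A weakly convergent sequence is pointwise convergent when its terms are read as functionals on the
  dual, and the dual is complete.
\<close>

lemma weakly_converges_pairing:
  fixes f :: "nat \<Rightarrow> ('b::real_normed_vector \<Rightarrow>\<^sub>L real)"
  assumes "weakly_converges y l" "f \<longlonglongrightarrow> g"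
  shows "(\<lambda>n. blinfun_apply (f n) (y n)) \<longlonglongrightarrow> blinfun_apply g l"
proof -
  have "(\<lambda>n. blinfun_apply (evaluation (y n)) (f n)) \<longlonglongrightarrow> blinfun_apply (evaluation l) g"
    by (rule pointwise_convergent_pairing) (use assms in \<open>simp_all add: weakly_converges_def\<close>)
  then show ?thesis by simp
qed

lemma tendsto_imp_weakly_converges: "y \<longlonglongrightarrow> l \<Longrightarrow> weakly_converges y l"
  by (simp add: weakly_converges_def blinfun.tendsto)

lemma weakly_converges_image:
  fixes T :: "'a::real_normed_vector \<Rightarrow> 'b::real_normed_vector"
  assumes "weakly_converges y l" "bounded_linear T"
  shows "weakly_converges (\<lambda>n. T (y n)) (T l)"
  unfolding weakly_converges_def
proof
  fix f :: "'b \<Rightarrow>\<^sub>L real"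
  have "bounded_linear (\<lambda>x. blinfun_apply f (T x))"
    using assms(2) by (rule bounded_linear_compose[OF blinfun.bounded_linear_right])
  from assms(1)[unfolded weakly_converges_def, rule_format, of "Blinfun (\<lambda>x. blinfun_apply f (T x))"]
  show "(\<lambda>n. blinfun_apply f (T (y n))) \<longlonglongrightarrow> blinfun_apply f (T l)"
    by (simp add: bounded_linear_Blinfun_apply[OF \<open>bounded_linear (\<lambda>x. blinfun_apply f (T x))\<close>])
qed

section \<open>Duals and products of reflexive spaces\<close>

text \<open>
  A functional \<open>\<Phi>\<close> on the bidual is evaluation at its own restriction \<open>x \<mapsto> \<Phi> (evaluation x)\<close>, since
  every element of the bidual is an evaluation.
\<close>

lemma reflexive_dual:
  assumes "reflexive_space TYPE('b::real_normed_vector)"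
  shows "reflexive_space TYPE('b \<Rightarrow>\<^sub>L real)"
  unfolding reflexive_space_def
proof
  fix \<Phi> :: "(('b \<Rightarrow>\<^sub>L real) \<Rightarrow>\<^sub>L real) \<Rightarrow>\<^sub>L real"
  have "bounded_linear (evaluation :: 'b \<Rightarrow> _)"
  proof (rule bounded_linear_intro[where K = 1])
    show "evaluation (x + y) = evaluation x + evaluation y" for x y :: 'b
      by (rule blinfun_eqI) (simp add: blinfun.add_left blinfun.add_right)
    show "evaluation (c *\<^sub>R x) = c *\<^sub>R evaluation x" for c and x :: 'b
      by (rule blinfun_eqI) (simp add: blinfun.scaleR_left blinfun.scaleR_right)
    show "norm (evaluation x) \<le> norm x * 1" for x :: 'b
      using norm_blinfun[of "_ :: 'b \<Rightarrow>\<^sub>L real" x] by (intro norm_blinfun_bound) (simp_all add: mult.commute)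
  qed
  then have bl: "bounded_linear (\<lambda>x::'b. blinfun_apply \<Phi> (evaluation x))"
    by (rule bounded_linear_compose[OF blinfun.bounded_linear_right])
  show "\<exists>f. \<forall>\<Psi>. blinfun_apply \<Phi> \<Psi> = blinfun_apply \<Psi> f"
  proof (intro exI allI)
    fix \<Psi> :: "('b \<Rightarrow>\<^sub>L real) \<Rightarrow>\<^sub>L real"
    obtain x where "\<And>f. blinfun_apply \<Psi> f = blinfun_apply f x"
      using assms unfolding reflexive_space_def by blast
    moreover from this have "\<Psi> = evaluation x" by (intro blinfun_eqI) simp
    ultimately show "blinfun_apply \<Phi> \<Psi> =
        blinfun_apply \<Psi> (Blinfun (\<lambda>x. blinfun_apply \<Phi> (evaluation x)))"
      by (simp add: bounded_linear_Blinfun_apply[OF bl])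
  qed
qed

text \<open>
  Every functional on the product is the sum of one that factors through the first projection \<open>P\<close> and
  one that factors through the second projection \<open>Q\<close>, so that \<open>\<Phi>\<close> is determined by the two functionals
  \<open>\<Phi>1\<close>, \<open>\<Phi>2\<close> on the dual spaces.
\<close>

lemma reflexive_prod:
  assumes a: "reflexive_space TYPE('b::real_normed_vector)"
    and b: "reflexive_space TYPE('c::real_normed_vector)"
  shows "reflexive_space TYPE('b \<times> 'c)"
  unfolding reflexive_space_def
proof
  fix \<Phi> :: "(('b \<times> 'c) \<Rightarrow>\<^sub>L real) \<Rightarrow>\<^sub>L real"
  define P where "P = Blinfun (fst :: 'b \<times> 'c \<Rightarrow> 'b)"
  define Q where "Q = Blinfun (snd :: 'b \<times> 'c \<Rightarrow> 'c)"
  have P: "blinfun_apply P z = fst z" and Q: "blinfun_apply Q z = snd z" for z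
    by (simp_all add: P_def Q_def bounded_linear_Blinfun_apply bounded_linear_fst bounded_linear_snd)
  define \<Phi>1 where "\<Phi>1 = Blinfun (\<lambda>f. blinfun_apply \<Phi> (f o\<^sub>L P))"
  define \<Phi>2 where "\<Phi>2 = Blinfun (\<lambda>f. blinfun_apply \<Phi> (f o\<^sub>L Q))"
  have \<Phi>1: "blinfun_apply \<Phi>1 f = blinfun_apply \<Phi> (f o\<^sub>L P)" for f
    unfolding \<Phi>1_def
    by (simp add: bounded_linear_Blinfun_apply[OF bounded_linear_compose[OF blinfun.bounded_linear_right
          bounded_bilinear.bounded_linear_left[OF bounded_bilinear_blinfun_compose]]])
  have \<Phi>2: "blinfun_apply \<Phi>2 f = blinfun_apply \<Phi> (f o\<^sub>L Q)" for f
    unfolding \<Phi>2_def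
    by (simp add: bounded_linear_Blinfun_apply[OF bounded_linear_compose[OF blinfun.bounded_linear_right
          bounded_bilinear.bounded_linear_left[OF bounded_bilinear_blinfun_compose]]])
  obtain x where x: "\<And>f. blinfun_apply \<Phi>1 f = blinfun_apply f x"
    using a unfolding reflexive_space_def by blast
  obtain y where y: "\<And>f. blinfun_apply \<Phi>2 f = blinfun_apply f y"
    using b unfolding reflexive_space_def by blast
  have bl1: "bounded_linear (\<lambda>x::'b. (x, 0::'c))" and bl2: "bounded_linear (\<lambda>y::'c. (0::'b, y))"
    by (intro bounded_linear_Pair bounded_linear_ident bounded_linear_zero)+
  show "\<exists>z. \<forall>f. blinfun_apply \<Phi> f = blinfun_apply f z"
  proof (intro exI allI)
    fix f :: "('b \<times> 'c) \<Rightarrow>\<^sub>L real"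
    let ?f1 = "f o\<^sub>L Blinfun (\<lambda>x::'b. (x, 0::'c))" and ?f2 = "f o\<^sub>L Blinfun (\<lambda>y::'c. (0::'b, y))"
    have f1: "blinfun_apply ?f1 s = blinfun_apply f (s, 0)" for s
      by (simp add: bounded_linear_Blinfun_apply[OF bl1])
    have f2: "blinfun_apply ?f2 t = blinfun_apply f (0, t)" for t
      by (simp add: bounded_linear_Blinfun_apply[OF bl2])
    have split: "blinfun_apply f (s, t) = blinfun_apply f (s, 0) + blinfun_apply f (0, t)" for s t
      by (simp flip: blinfun.add_right)
    have "f = (?f1 o\<^sub>L P) + (?f2 o\<^sub>L Q)"
    proof (rule blinfun_eqI)
      fix z :: "'b \<times> 'c"
      show "blinfun_apply f z = blinfun_apply ((?f1 o\<^sub>L P) + (?f2 o\<^sub>L Q)) z"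
        using split[of "fst z" "snd z"] by (simp add: blinfun.add_left P Q f1[simplified] f2[simplified])
    qed
    then have "blinfun_apply \<Phi> f = blinfun_apply \<Phi>1 ?f1 + blinfun_apply \<Phi>2 ?f2"
      unfolding \<Phi>1 \<Phi>2 by (metis blinfun.add_right)
    also have "\<dots> = blinfun_apply f (x, y)"
      unfolding x y f1 f2 by (rule split[symmetric])
    finally show "blinfun_apply \<Phi> f = blinfun_apply f (x, y)" .
  qed
qed

section \<open>Weak sequential compactness in reflexive spaces\<close>

text \<open>
  Finite rational combinations, coded by lists of coefficient-index pairs so that countability comes
  from the type. Their closure is stable under \<open>y \<mapsto> c *\<^sub>R x n + y\<close> for real \<open>c\<close>, because this map is jointly
  continuous in \<open>c\<close> and \<open>y\<close> and the rationals are dense.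
\<close>

lemma countable_dense_in_span:
  fixes x :: "nat \<Rightarrow> 'b::real_normed_vector"
  obtains D where "countable D" "span (range x) \<subseteq> closure D"
proof -
  define comb where "comb l = (\<Sum>(r, n)\<leftarrow>l. of_rat r *\<^sub>R x n)" for l :: "(rat \<times> nat) list"
  have add_scaled: "c *\<^sub>R x n + y \<in> closure (range comb)" if y: "y \<in> closure (range comb)" for c n y
  proof -
    define T where "T = (\<lambda>(c, y). c *\<^sub>R x n + y)"
    have "continuous_on (closure (\<rat> \<times> range comb)) T"
      unfolding T_def split_beta by (intro continuous_intros)
    moreover have "T ` (\<rat> \<times> range comb) \<subseteq> closure (range comb)"
    proof safe
      fix c :: real and l
      assume "c \<in> \<rat>"
      then obtain r where "c = of_rat r" by (rule Rats_cases)
      then have "T (c, comb l) = comb ((r, n) # l)" by (simp add: T_def comb_def)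
      then show "T (c, comb l) \<in> closure (range comb)"
        using subsetD[OF closure_subset, of _ "range comb"] by simp
    qed
    ultimately have "T ` closure (\<rat> \<times> range comb) \<subseteq> closure (range comb)"
      by (intro image_closure_subset) auto
    moreover have "(c, y) \<in> closure (\<rat> \<times> range comb)"
      using y by (simp add: closure_Times Rats_closure_real)
    ultimately show ?thesis by (auto simp: T_def)
  qed
  have "y \<in> closure (range comb)" if "y \<in> span (range x)" for y
    using that
  proof (induction rule: span_induct_alt)
    case base
    have "comb [] \<in> closure (range comb)" by (rule subsetD[OF closure_subset]) simp
    then show ?case by (simp add: comb_def)
  next
    case (step c y z)
    then show ?case using add_scaled by blast
  qed
  then have "span (range x) \<subseteq> closure (range comb)" by blast
  then show thesis by (rule that[rotated]) simp
qed

text \<open>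
  A limit in the sense of Banach: \<open>g \<mapsto> lim g (x n)\<close>, defined on the subspace of those functionals for
  which the limit exists, extends to a bounded functional on the dual by Hahn-Banach. By reflexivity
  the extension is evaluation at a point \<open>y\<close>.
\<close>

lemma generalized_weak_limit:
  fixes x :: "nat \<Rightarrow> 'b::real_normed_vector"
  assumes "reflexive_space TYPE('b)" and R: "\<And>n. norm (x n) \<le> R"
  obtains y where "\<And>(g :: 'b \<Rightarrow>\<^sub>L real) c. (\<lambda>n. blinfun_apply g (x n)) \<longlonglongrightarrow> c \<Longrightarrow> blinfun_apply g y = c"
proof -
  define S where "S = {g::'b \<Rightarrow>\<^sub>L real. convergent (\<lambda>n. blinfun_apply g (x n))}"
  define f where "f g = lim (\<lambda>n. blinfun_apply g (x n))" for g :: "'b \<Rightarrow>\<^sub>L real"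
  have f: "g \<in> S \<and> f g = c" if "(\<lambda>n. blinfun_apply g (x n)) \<longlonglongrightarrow> c" for g :: "'b \<Rightarrow>\<^sub>L real" and c
    using that by (auto simp: S_def f_def convergent_def limI)
  have lim: "(\<lambda>n. blinfun_apply g (x n)) \<longlonglongrightarrow> f g" if "g \<in> S" for g
    using that by (simp add: S_def f_def convergent_LIMSEQ_iff)
  have comb: "u *\<^sub>R g + v *\<^sub>R h \<in> S \<and> f (u *\<^sub>R g + v *\<^sub>R h) = u * f g + v * f h"
    if "g \<in> S" "h \<in> S" for g h u v
    by (rule f) (auto simp: blinfun.add_left blinfun.scaleR_left intro!: tendsto_intros lim that)
  have zero: "0 \<in> S" using f[of 0 0] by (simp add: blinfun.zero_left)
  have "0 \<le> R" using R[of 0] norm_ge_zero[of "x 0"] by linarith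
  have bound: "- (R * norm g) \<le> f g" if "g \<in> S" for g
  proof (rule LIMSEQ_le_const[OF lim[OF that]], intro exI allI impI)
    fix n
    have "\<bar>blinfun_apply g (x n)\<bar> \<le> norm g * norm (x n)"
      using norm_blinfun[of g "x n"] by simp
    also have "\<dots> \<le> R * norm g"
      using mult_left_mono[OF R[of n], of "norm g"] by (simp add: mult.commute)
    finally show "- (R * norm g) \<le> blinfun_apply g (x n)" by simp
  qed
  have "convex_on S f"
    using comb by (auto simp: convex_on_def convex_def)
  then obtain \<Phi> :: "('b \<Rightarrow>\<^sub>L real) \<Rightarrow>\<^sub>L real" where \<Phi>: "\<And>g. g \<in> S \<Longrightarrow> blinfun_apply \<Phi> g \<le> f g"
    using blinfun_sandwich[OF \<open>0 \<le> R\<close>, of S f] bound zero by blast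
  obtain y where y: "\<And>g. blinfun_apply \<Phi> g = blinfun_apply g y"
    using assms(1) unfolding reflexive_space_def by blast
  show thesis
  proof
    fix g :: "'b \<Rightarrow>\<^sub>L real" and c
    assume "(\<lambda>n. blinfun_apply g (x n)) \<longlonglongrightarrow> c"
    then have g: "g \<in> S" "f g = c" using f by blast+
    \<comment> \<open>Domination on the whole subspace S is equality: apply it to g and to - g.\<close>
    have "- g \<in> S" "f (- g) = - c"
      using comb[OF g(1) g(1), of "-1" 0] g(2) by auto
    with \<Phi>[of g] \<Phi>[of "- g"] g show "blinfun_apply g y = c"
      by (simp add: y blinfun.minus_left)
  qed
qed

text \<open>
  The closed span of the sequence is separable, so countably many functionals \<open>N d\<close> separate its
  points, and a diagonal subsequence \<open>x (r n)\<close> makes all \<open>N d (x (r n))\<close> converge. Every generalized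
  limit of every further subsequence lies in the closed span and has the same values under all \<open>N d\<close>,
  so all these limits are one point \<open>l\<close>. If \<open>g (x (r n))\<close> failed to converge to \<open>g l\<close>, some further
  subsequence would have a generalized limit on which \<open>g\<close> takes a different value.
\<close>

theorem bounded_imp_weakly_convergent_subseq:
  fixes x :: "nat \<Rightarrow> 'b::real_normed_vector"
  assumes refl: "reflexive_space TYPE('b)" and R: "\<And>n. norm (x n) \<le> R"
  obtains r l where "strict_mono (r :: nat \<Rightarrow> nat)" "weakly_converges (\<lambda>n. x (r n)) l"
proof -
  define M where "M = span (range x)"
  obtain D where D: "countable D" "M \<subseteq> closure D"
    unfolding M_def by (rule countable_dense_in_span)
  have MD: "closure M \<subseteq> closure D" using D(2) by (rule closure_minimal) simp
  \<comment> \<open>The difference of two points of closure M is a limit of differences of points of D.\<close>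
  define E where "E = (\<lambda>(a, b). a - b) ` (D \<times> D)"
  have "\<exists>g :: 'b \<Rightarrow>\<^sub>L real. norm g \<le> 1 \<and> blinfun_apply g d = norm d" for d
    using norming_functional by metis
  then obtain N :: "'b \<Rightarrow> ('b \<Rightarrow>\<^sub>L real)" where N: "\<And>d. norm (N d) \<le> 1"
    "\<And>d. blinfun_apply (N d) d = norm d"
    by metis
  have N_le: "\<bar>blinfun_apply (N d) v\<bar> \<le> norm v" for d v
    using norm_blinfun[of "N d" v] mult_right_mono[OF N(1)[of d], of "norm v"] by simp
  have "countable E" using D(1) by (simp add: E_def)
  have N_bound: "norm (blinfun_apply (N d) (x n)) \<le> R" for d n
    using order_trans[OF N_le R] by simp
  obtain r where r: "strict_mono (r :: nat \<Rightarrow> nat)"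
    "\<And>d. d \<in> E \<Longrightarrow> \<exists>c. (\<lambda>n. blinfun_apply (N d) (x (r n))) \<longlonglongrightarrow> c"
    using function_convergent_subsequence[OF \<open>countable E\<close>, of "\<lambda>n d. blinfun_apply (N d) (x n)" R]
      N_bound by blast
  then obtain c where c: "\<And>d. d \<in> E \<Longrightarrow> (\<lambda>n. blinfun_apply (N d) (x (r n))) \<longlonglongrightarrow> c d"
    by metis

  define gen_limit where "gen_limit s y \<longleftrightarrow>
    (\<forall>(g :: 'b \<Rightarrow>\<^sub>L real) a. (\<lambda>n. blinfun_apply g (x (r (s n)))) \<longlonglongrightarrow> a \<longrightarrow> blinfun_apply g y = a)"
    for s :: "nat \<Rightarrow> nat" and y
  have ex: "\<exists>y. gen_limit s y" for s
    using generalized_weak_limit[OF refl, of "\<lambda>n. x (r (s n))" R] R unfolding gen_limit_def by metis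
  have in_M: "y \<in> closure M" if "gen_limit s y" for s y
  proof (rule ccontr)
    assume "y \<notin> closure M"
    then obtain g :: "'b \<Rightarrow>\<^sub>L real" where g: "\<And>m. m \<in> M \<Longrightarrow> blinfun_apply g m = 0"
      "blinfun_apply g y \<noteq> 0"
      using functional_separating_subspace[of M y] by (auto simp: M_def)
    have "blinfun_apply g (x n) = 0" for n
      by (rule g) (simp add: M_def span_base)
    with that[unfolded gen_limit_def, rule_format, of g 0] g(2) show False by simp
  qed
  have N_gen_limit: "blinfun_apply (N d) y = c d" if "gen_limit s y" "strict_mono s" "d \<in> E" for s y d
    using LIMSEQ_subseq_LIMSEQ[OF c[OF that(3)] that(2)] that(1)
    by (simp add: gen_limit_def o_def)
  have unique: "y = z" if yz: "gen_limit s y" "gen_limit t z" "strict_mono s" "strict_mono t" for s t y z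
  proof -
    have "norm (y - z) \<le> 0 + e" if e: "0 < e" for e
    proof -
      have "y \<in> closure D" "z \<in> closure D" using in_M MD yz by blast+
      moreover have "0 < e / 4" using e by simp
      ultimately obtain a b where ab: "a \<in> D" "b \<in> D" "dist a y < e / 4" "dist b z < e / 4"
        unfolding closure_approachable by blast
      let ?N = "N (a - b)"
      have "a - b \<in> E" using ab by (auto simp: E_def)
      then have "blinfun_apply ?N y = blinfun_apply ?N z"
        using N_gen_limit yz by metis
      then have "norm (a - b) = blinfun_apply ?N (a - y) - blinfun_apply ?N (b - z)"
        using N(2)[of "a - b"] by (simp add: blinfun.diff_right)
      with N_le[of "a - b" "a - y"] N_le[of "a - b" "b - z"]
      have "norm (a - b) \<le> norm (a - y) + norm (b - z)" by linarith
      moreover have "norm (y - z) \<le> norm (a - y) + norm (a - b) + norm (b - z)"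
        using norm_triangle_ineq4[of "a - b" "a - y"] norm_triangle_ineq[of "y - b" "b - z"]
        by simp
      ultimately show ?thesis using ab(3,4) by (simp add: dist_norm)
    qed
    then have "norm (y - z) \<le> 0" by (rule field_le_epsilon)
    then show ?thesis by simp
  qed
  obtain l where l: "gen_limit id l" using ex by blast
  have "(\<lambda>n. blinfun_apply g (x (r n))) \<longlonglongrightarrow> blinfun_apply g l" for g :: "'b \<Rightarrow>\<^sub>L real"
  proof (rule ccontr)
    assume "\<not> ?thesis"
    then obtain e where e: "0 < e"
      "\<exists>\<^sub>F n in sequentially. e \<le> dist (blinfun_apply g (x (r n))) (blinfun_apply g l)"
      by (auto simp: tendsto_iff not_eventually not_less)
    then have "infinite {n. e \<le> dist (blinfun_apply g (x (r n))) (blinfun_apply g l)}"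
      by (simp add: cofinite_eq_sequentially[symmetric] frequently_cofinite)
    then obtain s :: "nat \<Rightarrow> nat" where s: "strict_mono s"
      "\<And>n. e \<le> dist (blinfun_apply g (x (r (s n)))) (blinfun_apply g l)"
      using infinite_enumerate[of "{n. e \<le> dist (blinfun_apply g (x (r n))) (blinfun_apply g l)}"]
      by auto
    have "bounded (range (\<lambda>n. blinfun_apply g (x (r (s n)))))"
      unfolding bounded_iff
    proof (intro exI ballI)
      fix v assume "v \<in> range (\<lambda>n. blinfun_apply g (x (r (s n))))"
      then obtain n where "v = blinfun_apply g (x (r (s n)))" by auto
      then show "norm v \<le> norm g * R"
        using norm_blinfun[of g "x (r (s n))"] mult_left_mono[OF R[of "r (s n)"], of "norm g"]
        by simp
    qed
    then obtain a t where t: "strict_mono (t :: nat \<Rightarrow> nat)"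
      "((\<lambda>n. blinfun_apply g (x (r (s n)))) \<circ> t) \<longlonglongrightarrow> a"
      using bounded_imp_convergent_subsequence by blast
    obtain z where z: "gen_limit (s \<circ> t) z" using ex by blast
    have "z = l"
      by (rule unique[OF z l strict_mono_o[OF s(1) t(1)]]) (simp add: strict_mono_def)
    with z t(2) have "blinfun_apply g l = a"
      by (auto simp: gen_limit_def o_def)
    moreover have "e \<le> dist a (blinfun_apply g l)"
      using LIMSEQ_le_const[OF tendsto_dist[OF t(2) tendsto_const], of e "blinfun_apply g l"] s(2) by simp
    ultimately show False using e(1) by simp
  qed
  then have "weakly_converges (\<lambda>n. x (r n)) l" unfolding weakly_converges_def by blast
  with r(1) show thesis by (rule that)
qed

section \<open>Selfdual Lagrangians\<close>

text \<open>
  The identification of the dual of phase space with phase space itself: reflexivity represents the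
  second component of \<open>g\<close> by a vector. The bound on \<open>norm v\<close> uses a functional that attains the norm at
  \<open>v\<close>.
\<close>

lemma phase_functional:
  fixes g :: "'a::real_normed_vector phase \<Rightarrow>\<^sub>L real"
  assumes "reflexive_space TYPE('a)"
  obtains v q where "norm v \<le> norm g" "norm q \<le> norm g"
    "\<And>x f. blinfun_apply g (x, f) = blinfun_apply q x + blinfun_apply f v"
proof -
  have bl1: "bounded_linear (\<lambda>x::'a. blinfun_apply g (x, 0))"
    by (intro bounded_linear_compose[OF blinfun.bounded_linear_right]
        bounded_linear_Pair bounded_linear_ident bounded_linear_zero)
  have bl2: "bounded_linear (\<lambda>f::'a \<Rightarrow>\<^sub>L real. blinfun_apply g (0, f))"
    by (intro bounded_linear_compose[OF blinfun.bounded_linear_right]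
        bounded_linear_Pair bounded_linear_ident bounded_linear_zero)
  define q where "q = Blinfun (\<lambda>x::'a. blinfun_apply g (x, 0))"
  have q: "blinfun_apply q x = blinfun_apply g (x, 0)" for x
    by (simp add: q_def bounded_linear_Blinfun_apply[OF bl1])
  obtain v where "\<And>f. blinfun_apply (Blinfun (\<lambda>f::'a \<Rightarrow>\<^sub>L real. blinfun_apply g (0, f))) f = blinfun_apply f v"
    using assms unfolding reflexive_space_def by blast
  then have v: "blinfun_apply f v = blinfun_apply g (0, f)" for f
    by (simp add: bounded_linear_Blinfun_apply[OF bl2])
  show thesis
  proof
    show "norm q \<le> norm g"
      using norm_blinfun[of g "(_, 0)"] by (intro norm_blinfun_bound) (simp_all add: q norm_Pair)
    obtain f where f: "norm f \<le> 1" "blinfun_apply f v = norm v"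
      by (rule norming_functional)
    have "norm v \<le> norm g * norm f"
      using norm_blinfun[of g "(0, f)"] f(2) by (simp add: v norm_Pair)
    also have "\<dots> \<le> norm g"
      using mult_left_mono[OF f(1), of "norm g"] by simp
    finally show "norm v \<le> norm g" .
    show "blinfun_apply g (x, f) = blinfun_apply q x + blinfun_apply f v" for x f
      by (simp add: q v flip: blinfun.add_right)
  qed
qed

lemma Lagrangian_not_MInf: "Lagrangian L \<Longrightarrow> L z \<noteq> -\<infinity>"
  unfolding Lagrangian_def by blast

text \<open>
  The Fenchel-Young inequality, with the conjugate replaced by \<open>L\<close> itself.
\<close>

lemma selfdual_Lagrangian_pairing_le:
  assumes "selfdual_Lagrangian L"
  shows "ereal (blinfun_apply p v + blinfun_apply q u) - L (v, q) \<le> L (u, p)"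
proof -
  have "ereal (blinfun_apply p v + blinfun_apply q u) - L (v, q) \<le> phase_conjugate L p u"
    unfolding phase_conjugate_def by (rule SUP_upper2[of "(v, q)"]) auto
  then show ?thesis using assms by (simp add: selfdual_Lagrangian_def)
qed

text \<open>
  As a conjugate, \<open>L\<close> is a supremum of continuous affine functions, hence convex and lower
  semicontinuous.
\<close>

lemma fixed_point_of_conjugation_selfdual:
  assumes L: "Lagrangian L" and eq: "\<And>u p. phase_conjugate L p u = L (u, p)"
  shows "selfdual_Lagrangian L"
proof -
  define T where "T y z = ereal (blinfun_apply (snd z) (fst y) + blinfun_apply (snd y) (fst z)) - L y"
    for y z
  have L_SUP: "L z = (SUP y. T y z)" for z
    using eq[of "snd z" "fst z"] by (simp add: phase_conjugate_def T_def split_beta)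
  have "convex_ereal L"
    unfolding convex_ereal_def
  proof (intro allI impI)
    fix x y :: "'a phase" and t :: real
    assume t: "0 < t \<and> t < 1"
    show "L ((1 - t) *\<^sub>R x + t *\<^sub>R y) \<le> ereal (1 - t) * L x + ereal t * L y"
      unfolding L_SUP[of "(1 - t) *\<^sub>R x + t *\<^sub>R y"]
    proof (rule SUP_least)
      fix w
      have "T w ((1 - t) *\<^sub>R x + t *\<^sub>R y) \<le> ereal (1 - t) * T w x + ereal t * T w y"
      proof (cases "L w")
        case (real c)
        then show ?thesis
          by (simp add: T_def blinfun.add_left blinfun.add_right blinfun.scaleR_left
              blinfun.scaleR_right blinfun.diff_left blinfun.diff_right algebra_simps)
      next
        case PInf
        then show ?thesis by (simp add: T_def)
      next
        case MInf
        then show ?thesis using Lagrangian_not_MInf[OF L] by blast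
      qed
      also have "\<dots> \<le> ereal (1 - t) * L x + ereal t * L y"
        using t by (intro add_mono ereal_mult_left_mono) (auto simp: L_SUP intro: SUP_upper)
      finally show "T w ((1 - t) *\<^sub>R x + t *\<^sub>R y) \<le> ereal (1 - t) * L x + ereal t * L y" .
    qed
  qed
  moreover have "lower_semicontinuous L"
    unfolding lower_semicontinuous_def
  proof
    fix c :: real
    have "{z. L z \<le> ereal c} = (\<Inter>y. {z. T y z \<le> ereal c})"
      by (auto simp: L_SUP SUP_le_iff)
    also have "closed \<dots>"
    proof (intro closed_INT ballI)
      fix y
      show "closed {z. T y z \<le> ereal c}"
      proof (cases "L y")
        case (real d)
        then show ?thesis
          by (simp add: T_def) (intro closed_Collect_le continuous_intros)
      next
        case PInf
        then show ?thesis by (simp add: T_def)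
      next
        case MInf
        then show ?thesis using Lagrangian_not_MInf[OF L] by blast
      qed
    qed
    finally show "closed {z. L z \<le> ereal c}" .
  qed
  ultimately show ?thesis
    using L eq by (simp add: selfdual_Lagrangian_def)
qed

text \<open>
  Fenchel duality for the infimum of \<open>K z + R * norm (z - y)\<close>. If this infimum is at least \<open>b\<close>, the sandwich
  theorem places a continuous affine function of slope at most \<open>R\<close> and value \<open>b\<close> at \<open>y\<close> below \<open>K\<close>. Its
  slope is a point \<open>(v, q)\<close> of phase space, and the affine minorant bounds the conjugate of \<open>K\<close> there,
  which is \<open>K (v, q)\<close>. The norm penalty is what makes \<open>(v, q)\<close> bounded.
\<close>

lemma selfdual_Lagrangian_dual_minorant:
  fixes K :: "'a::real_normed_vector phase \<Rightarrow> ereal"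
  assumes refl: "reflexive_space TYPE('a)" and K: "selfdual_Lagrangian K" and R: "0 \<le> R"
    and lower: "\<And>z. ereal (b - R * norm (z - y)) \<le> K z"
  obtains v q where "norm v \<le> R" "norm q \<le> R"
    "K (v, q) \<le> ereal (blinfun_apply q (fst y) + blinfun_apply (snd y) v - b)"
proof -
  have notM: "K z \<noteq> -\<infinity>" for z
    using K by (simp add: selfdual_Lagrangian_def Lagrangian_not_MInf)
  define S where "S = {h. K (y + h) \<noteq> \<infinity>}"
  define f where "f h = real_of_ereal (K (y + h)) - b" for h
  have K_real: "K (y + h) = ereal (f h + b)" if "h \<in> S" for h
    using that notM[of "y + h"] by (cases "K (y + h)") (auto simp: S_def f_def)
  have comb: "(1 - t) *\<^sub>R h + t *\<^sub>R k \<in> S \<and> f ((1 - t) *\<^sub>R h + t *\<^sub>R k) \<le> (1 - t) * f h + t * f k"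
    if hk: "h \<in> S" "k \<in> S" and t: "0 < t" "t < 1" for h k t
  proof -
    have eq: "(1 - t) *\<^sub>R (y + h) + t *\<^sub>R (y + k) = y + ((1 - t) *\<^sub>R h + t *\<^sub>R k)"
      by (simp add: algebra_simps)
    have "K (y + ((1 - t) *\<^sub>R h + t *\<^sub>R k)) \<le> ereal (1 - t) * K (y + h) + ereal t * K (y + k)"
      using K t unfolding eq[symmetric] selfdual_Lagrangian_def convex_ereal_def by blast
    also have "\<dots> = ereal ((1 - t) * f h + t * f k + b)"
      by (simp add: K_real[OF hk(1)] K_real[OF hk(2)]) (simp add: algebra_simps)
    finally have le: "K (y + ((1 - t) *\<^sub>R h + t *\<^sub>R k)) \<le> ereal ((1 - t) * f h + t * f k + b)" .
    then have "(1 - t) *\<^sub>R h + t *\<^sub>R k \<in> S" by (auto simp: S_def)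
    with le K_real[OF this] show ?thesis by simp
  qed
  have "convex_on S f"
  proof (rule convex_onI)
    show "convex S"
      unfolding convex_alt
    proof (intro ballI allI impI)
      fix h k and t :: real
      assume hk: "h \<in> S" "k \<in> S" and "0 \<le> t \<and> t \<le> 1"
      then consider "t = 0" | "t = 1" | "0 < t" "t < 1" by linarith
      then show "(1 - t) *\<^sub>R h + t *\<^sub>R k \<in> S"
        using hk comb by cases auto
    qed
  qed (use comb in blast)
  moreover have "S \<noteq> {}"
  proof
    assume "S = {}"
    then have "z - y \<notin> S" for z by simp
    then have inf: "K z = \<infinity>" for z by (simp add: S_def)
    have "phase_conjugate K 0 0 = -\<infinity>"
      by (simp add: phase_conjugate_def inf split_beta)
    then show False using K notM[of "(0, 0)"] by (simp add: selfdual_Lagrangian_def)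
  qed
  moreover have "- (R * norm h) \<le> f h" if "h \<in> S" for h
    using lower[of "y + h"] K_real[OF that] by simp
  ultimately obtain g where g: "norm g \<le> R" "\<And>h. h \<in> S \<Longrightarrow> blinfun_apply g h \<le> f h"
    using blinfun_sandwich[OF R] by metis
  obtain v q where vq: "norm v \<le> norm g" "norm q \<le> norm g"
    "\<And>x f. blinfun_apply g (x, f) = blinfun_apply q x + blinfun_apply f v"
    using phase_functional[OF refl, of g] by blast
  show thesis
  proof
    show "norm v \<le> R" "norm q \<le> R" using vq(1,2) g(1) by simp_all
    have "phase_conjugate K q v \<le> ereal (blinfun_apply q (fst y) + blinfun_apply (snd y) v - b)"
      unfolding phase_conjugate_def
    proof (rule SUP_least, clarify)
      fix x r
      let ?h = "(x, r) - y"
      show "ereal (blinfun_apply q x + blinfun_apply r v) - K (x, r)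
        \<le> ereal (blinfun_apply q (fst y) + blinfun_apply (snd y) v - b)"
      proof (cases "?h \<in> S")
        case True
        have "blinfun_apply g ?h = blinfun_apply q (x - fst y) + blinfun_apply (r - snd y) v"
          using vq(3)[of "x - fst y" "r - snd y"] by (simp add: minus_prod_def)
        with g(2)[OF True] K_real[OF True] show ?thesis
          by (simp add: blinfun.diff_left blinfun.diff_right)
      next
        case False
        then show ?thesis by (simp add: S_def)
      qed
    qed
    then show "K (v, q) \<le> ereal (blinfun_apply q (fst y) + blinfun_apply (snd y) v - b)"
      using K by (simp add: selfdual_Lagrangian_def)
  qed
qed

text \<open>
  Test the selfduality of \<open>Ln n\<close> at \<open>w n\<close> with a recovery sequence \<open>y n\<close> of \<open>(v, q)\<close>: the pairing of the
  weakly convergent \<open>w n\<close> with the strongly convergent \<open>y n\<close> passes to the limit. Recovery sequences of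
  \<open>L\<close> therefore yield a liminf inequality along weakly convergent sequences.
\<close>

lemma conjugate_le_liminf_if_recovery:
  fixes Ln :: "nat \<Rightarrow> 'a::banach phase \<Rightarrow> ereal"
  assumes sd: "\<And>n. selfdual_Lagrangian (Ln n)" and L: "Lagrangian L"
    and rec: "\<And>z. \<exists>y. y \<longlonglongrightarrow> z \<and> limsup (\<lambda>n. Ln n (y n)) \<le> L z"
    and w: "weakly_converges w l"
  shows "phase_conjugate L (snd l) (fst l) \<le> liminf (\<lambda>n. Ln n (w n))"
  unfolding phase_conjugate_def
proof (rule SUP_least, clarify)
  fix v :: 'a and q :: "'a \<Rightarrow>\<^sub>L real"
  let ?a = "blinfun_apply (snd l) v + blinfun_apply q (fst l)"
  obtain y where y: "y \<longlonglongrightarrow> (v, q)" "limsup (\<lambda>n. Ln n (y n)) \<le> L (v, q)"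
    using rec by blast
  define a where "a n = blinfun_apply (snd (w n)) (fst (y n)) + blinfun_apply (snd (y n)) (fst (w n))"
    for n
  have "weakly_converges (\<lambda>n. fst (w n)) (fst l)" "weakly_converges (\<lambda>n. snd (w n)) (snd l)"
    using weakly_converges_image[OF w] bounded_linear_fst bounded_linear_snd by blast+
  note ws = this
  have "(\<lambda>n. blinfun_apply (snd (w n)) x) \<longlonglongrightarrow> blinfun_apply (snd l) x" for x
    using ws(2)[unfolded weakly_converges_def, rule_format, of "evaluation x"] by simp
  then have "(\<lambda>n. blinfun_apply (snd (w n)) (fst (y n))) \<longlonglongrightarrow> blinfun_apply (snd l) v"
    using pointwise_convergent_pairing[of "\<lambda>n. snd (w n)" "snd l", OF _ tendsto_fst[OF y(1)]] by simp
  moreover have "(\<lambda>n. blinfun_apply (snd (y n)) (fst (w n))) \<longlonglongrightarrow> blinfun_apply q (fst l)"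
    using weakly_converges_pairing[OF ws(1) tendsto_snd[OF y(1)]] by simp
  ultimately have a: "a \<longlonglongrightarrow> ?a"
    unfolding a_def by (rule tendsto_add)
  have le: "ereal (a n) - Ln n (y n) \<le> Ln n (w n)" for n
    using selfdual_Lagrangian_pairing_le[OF sd, of "snd (w n)" "fst (y n)" "snd (y n)" "fst (w n)" n]
    by (simp add: a_def)
  show "ereal ?a - L (v, q) \<le> liminf (\<lambda>n. Ln n (w n))"
  proof (cases "L (v, q)")
    case (real c)
    show ?thesis
    proof (rule ereal_le_epsilon2)
      fix e :: real
      assume e: "0 < e"
      have "limsup (\<lambda>n. Ln n (y n)) < ereal (c + e / 2)"
        using y(2) by (rule order_le_less_trans) (simp add: real e)
      then have "\<forall>\<^sub>F n in sequentially. Ln n (y n) < ereal (c + e / 2)"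
        by (rule Limsup_lessD)
      moreover have "\<forall>\<^sub>F n in sequentially. ?a - e / 2 < a n"
        using a e by (intro order_tendstoD) auto
      ultimately have "\<forall>\<^sub>F n in sequentially. ereal (?a - c - e) \<le> Ln n (w n)"
      proof eventually_elim
        case (elim n)
        have "ereal (?a - c - e) \<le> ereal (a n) - Ln n (y n)"
          using elim by (cases "Ln n (y n)") auto
        also note le
        finally show ?case .
      qed
      then have "ereal (?a - c - e) \<le> liminf (\<lambda>n. Ln n (w n))"
        by (rule Liminf_bounded)
      then show "ereal ?a - L (v, q) \<le> liminf (\<lambda>n. Ln n (w n)) + ereal e"
        by (cases "liminf (\<lambda>n. Ln n (w n))") (auto simp: real)
    qed
  next
    case PInf
    then show ?thesis by simp
  next
    case MInf
    then show ?thesis using Lagrangian_not_MInf[OF L] by blast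
  qed
qed

text \<open>
  Fill the gaps of the subsequence with the limit \<open>l\<close>; the full sequence still converges weakly, and
  its liminf is at most that of the subsequence.
\<close>

lemma liminf_inequality_along_subseq:
  fixes Fn :: "nat \<Rightarrow> 'b::real_normed_vector \<Rightarrow> ereal"
  assumes F: "\<And>y l. weakly_converges y l \<Longrightarrow> F l \<le> liminf (\<lambda>n. Fn n (y n))"
    and r: "strict_mono r" and y: "weakly_converges y l"
  shows "F l \<le> liminf (\<lambda>k. Fn (r k) (y k))"
proof -
  have inj: "inj r" using r by (rule strict_mono_imp_inj_on)
  define Y where "Y n = (if n \<in> range r then y (inv r n) else l)" for n
  have Y: "Y (r k) = y k" for k by (simp add: Y_def inj)
  have "weakly_converges Y l"
    unfolding weakly_converges_def
  proof
    fix g :: "'b \<Rightarrow>\<^sub>L real"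
    show "(\<lambda>n. blinfun_apply g (Y n)) \<longlonglongrightarrow> blinfun_apply g l"
    proof (rule LIMSEQ_I)
      fix e :: real
      assume e: "0 < e"
      have "(\<lambda>k. blinfun_apply g (y k)) \<longlonglongrightarrow> blinfun_apply g l"
        using y by (simp add: weakly_converges_def)
      then obtain N where N: "\<And>k. N \<le> k \<Longrightarrow> norm (blinfun_apply g (y k) - blinfun_apply g l) < e"
        using LIMSEQ_D e by blast
      show "\<exists>m. \<forall>n\<ge>m. norm (blinfun_apply g (Y n) - blinfun_apply g l) < e"
      proof (intro exI allI impI)
        fix n assume n: "r N \<le> n"
        show "norm (blinfun_apply g (Y n) - blinfun_apply g l) < e"
        proof (cases "n \<in> range r")
          case True
          then obtain k where k: "n = r k" by blast
          then have "N \<le> k" using n r by (simp add: strict_mono_less_eq)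
          with N k Y show ?thesis by simp
        next
          case False
          with e show ?thesis by (simp add: Y_def)
        qed
      qed
    qed
  qed
  then have "F l \<le> liminf (\<lambda>n. Fn n (Y n))" by (rule F)
  also have "\<dots> \<le> liminf ((\<lambda>n. Fn n (Y n)) \<circ> r)" using r by (rule liminf_subseq_mono)
  finally show ?thesis by (simp add: o_def Y)
qed

text \<open>
  Otherwise duality gives, for all large \<open>n\<close>, a point \<open>w n\<close> of norm at most \<open>2 * R\<close> with
  \<open>Ln n (w n) \<le> B (w n) - b\<close>, where \<open>B\<close> is the pairing with \<open>y\<close>. At a weak limit \<open>l\<close> of a subsequence the
  liminf inequality gives \<open>b \<le> B l - L l\<close>, and the right-hand side is at most the conjugate of \<open>L\<close>, which
  is at most \<open>a\<close>; but \<open>a < b\<close>.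
\<close>

lemma frequently_near_minimisers:
  fixes Ln :: "nat \<Rightarrow> 'a::banach phase \<Rightarrow> ereal"
  assumes refl: "reflexive_space TYPE('a)" and sd: "\<And>n. selfdual_Lagrangian (Ln n)"
    and L: "Lagrangian L"
    and liminf: "\<And>y l. weakly_converges y l \<Longrightarrow> L l \<le> liminf (\<lambda>n. Ln n (y n))"
    and a: "phase_conjugate L (snd y) (fst y) \<le> ereal a" and b: "a < b" and R: "0 \<le> R"
  shows "\<exists>\<^sub>F n in sequentially. \<exists>z. Ln n z < ereal (b - R * norm (z - y))"
proof (rule ccontr)
  assume "\<not> ?thesis"
  then obtain N where N: "\<And>n z. N \<le> n \<Longrightarrow> ereal (b - R * norm (z - y)) \<le> Ln n z"
    by (auto simp: not_frequently eventually_sequentially not_less)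
  define B where "B w = blinfun_apply (snd w) (fst y) + blinfun_apply (snd y) (fst w)"
    for w :: "'a phase"
  have "\<exists>w. norm w \<le> 2 * R \<and> Ln (N + n) w \<le> ereal (B w - b)" for n
  proof -
    obtain v q where vq: "norm v \<le> R" "norm q \<le> R"
      "Ln (N + n) (v, q) \<le> ereal (blinfun_apply q (fst y) + blinfun_apply (snd y) v - b)"
      by (rule selfdual_Lagrangian_dual_minorant[OF refl sd R, of b y "N + n"]) (auto intro: N)
    have "norm (v, q) \<le> 2 * R"
      using norm_Pair_le[of v q] vq(1,2) by linarith
    with vq(3) show ?thesis by (intro exI[of _ "(v, q)"]) (simp add: B_def)
  qed
  then obtain w where w: "\<And>n. norm (w n) \<le> 2 * R" "\<And>n. Ln (N + n) (w n) \<le> ereal (B (w n) - b)"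
    by metis
  obtain r l where r: "strict_mono r" and l: "weakly_converges (\<lambda>n. w (r n)) l"
    using bounded_imp_weakly_convergent_subseq[OF reflexive_prod[OF refl reflexive_dual[OF refl]]] w(1)
    by metis
  have ws: "weakly_converges (\<lambda>n. fst (w (r n))) (fst l)" "weakly_converges (\<lambda>n. snd (w (r n))) (snd l)"
    using weakly_converges_image[OF l] bounded_linear_fst bounded_linear_snd by blast+
  have "(\<lambda>n. blinfun_apply (snd (w (r n))) (fst y)) \<longlonglongrightarrow> blinfun_apply (snd l) (fst y)"
    using ws(2)[unfolded weakly_converges_def, rule_format, of "evaluation (fst y)"] by simp
  moreover have "(\<lambda>n. blinfun_apply (snd y) (fst (w (r n)))) \<longlonglongrightarrow> blinfun_apply (snd y) (fst l)"
    using ws(1) by (simp add: weakly_converges_def)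
  ultimately have "(\<lambda>n. B (w (r n)) - b) \<longlonglongrightarrow> B l - b"
    unfolding B_def by (intro tendsto_diff tendsto_add tendsto_const)
  then have lim: "liminf (\<lambda>n. ereal (B (w (r n)) - b)) = ereal (B l - b)"
    by (intro lim_imp_Liminf tendsto_ereal) auto
  have "strict_mono (\<lambda>k. N + r k)" using r by (simp add: strict_mono_def)
  then have "L l \<le> liminf (\<lambda>k. Ln (N + r k) (w (r k)))"
    using liminf_inequality_along_subseq[of L Ln "\<lambda>k. N + r k" "\<lambda>k. w (r k)" l] liminf l by blast
  also have "\<dots> \<le> liminf (\<lambda>n. ereal (B (w (r n)) - b))"
    by (intro Liminf_mono always_eventually allI w(2))
  finally have "L l \<le> ereal (B l - b)" by (simp add: lim)
  moreover have "ereal (B l) - L l \<le> phase_conjugate L (snd y) (fst y)"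
    unfolding phase_conjugate_def by (rule SUP_upper2[of l]) (auto simp: B_def split_beta add.commute)
  with a have "ereal (B l) - L l \<le> ereal a" by (rule order_trans[rotated])
  moreover have "L l \<noteq> -\<infinity>" using Lagrangian_not_MInf[OF L] by blast
  ultimately show False using b by (cases "L l") auto
qed

text \<open>
  Selfduality tested against the bounded sequence \<open>y\<close>, on which the \<open>Ln\<close> are bounded above.
\<close>

lemma eventually_linear_lower_bound:
  fixes Ln :: "nat \<Rightarrow> 'a::banach phase \<Rightarrow> ereal"
  assumes sd: "\<And>n. selfdual_Lagrangian (Ln n)"
    and y: "y \<longlonglongrightarrow> z0" and lim: "limsup (\<lambda>n. Ln n (y n)) < ereal c"
  obtains C where "0 \<le> C" "\<forall>\<^sub>F n in sequentially. \<forall>z. ereal (- C - C * norm z) \<le> Ln n z"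
proof -
  define B where "B = norm z0 + 1"
  define C where "C = 2 * B + \<bar>c\<bar>"
  have "\<forall>\<^sub>F n in sequentially. norm (y n) < B"
    using tendsto_norm[OF y] by (rule order_tendstoD) (simp add: B_def)
  moreover have "\<forall>\<^sub>F n in sequentially. Ln n (y n) < ereal c"
    using lim by (rule Limsup_lessD)
  ultimately have "\<forall>\<^sub>F n in sequentially. \<forall>z. ereal (- C - C * norm z) \<le> Ln n z"
  proof eventually_elim
    case (elim n)
    show ?case
    proof
      fix z
      let ?s = "blinfun_apply (snd z) (fst (y n)) + blinfun_apply (snd (y n)) (fst z)"
      have fs: "norm (fst x) \<le> norm x" "norm (snd x) \<le> norm x" for x :: "'a phase"
        using norm_fst_le[of "fst x" "snd x"] norm_snd_le[of "snd x" "fst x"] by simp_all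
      have "\<bar>blinfun_apply (snd z) (fst (y n))\<bar> \<le> norm (snd z) * norm (fst (y n))"
        using norm_blinfun[of "snd z" "fst (y n)"] by simp
      also have "\<dots> \<le> norm z * B"
        using fs[of z] fs[of "y n"] elim(1) by (intro mult_mono) auto
      finally have 1: "\<bar>blinfun_apply (snd z) (fst (y n))\<bar> \<le> norm z * B" .
      have "\<bar>blinfun_apply (snd (y n)) (fst z)\<bar> \<le> norm (snd (y n)) * norm (fst z)"
        using norm_blinfun[of "snd (y n)" "fst z"] by simp
      also have "\<dots> \<le> B * norm z"
        using fs[of z] fs[of "y n"] elim(1) by (intro mult_mono) (auto simp: B_def)
      finally have 2: "\<bar>blinfun_apply (snd (y n)) (fst z)\<bar> \<le> B * norm z" .
      have "C * norm z = norm z * B + B * norm z + \<bar>c\<bar> * norm z"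
        by (simp add: C_def algebra_simps)
      moreover have "0 \<le> \<bar>c\<bar> * norm z" by simp
      moreover have "c \<le> C"
        by (simp add: C_def B_def add_increasing abs_ge_self)
      ultimately have "- C - C * norm z \<le> ?s - c"
        using 1 2 by linarith
      then have "ereal (- C - C * norm z) \<le> ereal ?s - ereal c" by simp
      also have "\<dots> \<le> ereal ?s - Ln n (y n)"
        using elim(2) by (intro ereal_minus_mono) auto
      also have "\<dots> \<le> Ln n z"
        using selfdual_Lagrangian_pairing_le[OF sd, of "snd z" "fst (y n)" "snd (y n)" "fst z" n] by simp
      finally show "ereal (- C - C * norm z) \<le> Ln n z" .
    qed
  qed
  moreover have "0 \<le> C" by (simp add: C_def B_def)
  ultimately show thesis using that by blast
qed

lemma strict_mono_choice_if_frequently: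
  assumes "\<And>k::nat. \<exists>\<^sub>F n in sequentially. P k n"
  obtains r where "strict_mono (r :: nat \<Rightarrow> nat)" "\<And>k. P k (r k)"
proof -
  have ex: "\<exists>n>m. P k n" for k m
    using assms[of k] by (metis Suc_le_lessD frequently_sequentially)
  have "\<exists>r. \<forall>k. P k (r k) \<and> r k < r (Suc k)"
    by (rule dependent_nat_choice) (use ex in auto)
  then show thesis using that by (auto simp: strict_mono_Suc_iff)
qed

text \<open>
  Let \<open>a\<close> be the conjugate at \<open>y\<close>. Letting the penalty \<open>R = k\<close> grow along a subsequence yields points \<open>z k\<close>
  with \<open>Ln (r k) (z k) + k * norm (z k - y) < a + 1 / (k + 1)\<close>. The \<open>Ln\<close> decrease at most linearly, so
  the penalty forces \<open>z k\<close> to tend to \<open>y\<close>, and the liminf inequality gives \<open>L y \<le> a\<close>. Properness supplies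
  the recovery sequence behind the linear lower bound.
\<close>

lemma Mosco_limit_le_conjugate:
  fixes Ln :: "nat \<Rightarrow> 'a::banach phase \<Rightarrow> ereal"
  assumes refl: "reflexive_space TYPE('a)" and sd: "\<And>n. selfdual_Lagrangian (Ln n)"
    and L: "Lagrangian L" and proper: "proper_fun L" and Mosco: "Mosco_converges Ln L"
  shows "L y \<le> phase_conjugate L (snd y) (fst y)"
proof -
  have liminf: "L l \<le> liminf (\<lambda>n. Ln n (y n))" if "weakly_converges y l" for y l
    using Mosco that unfolding Mosco_converges_def by blast
  obtain z0 where "L z0 \<noteq> \<infinity>" using proper by (auto simp: proper_fun_def)
  then obtain c where c: "L z0 = ereal c"
    using Lagrangian_not_MInf[OF L, of z0] by (cases "L z0") auto
  obtain x where x: "x \<longlonglongrightarrow> z0" "(\<lambda>n. Ln n (x n)) \<longlonglongrightarrow> L z0"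
    using Mosco unfolding Mosco_converges_def by blast
  have "limsup (\<lambda>n. Ln n (x n)) < ereal (c + 1)"
    using lim_imp_Limsup[OF _ x(2)] by (simp add: c)
  then obtain C where C: "0 \<le> C" "\<forall>\<^sub>F n in sequentially. \<forall>z. ereal (- C - C * norm z) \<le> Ln n z"
    using eventually_linear_lower_bound[of Ln x z0, OF sd x(1)] by blast
  show ?thesis
  proof (cases "phase_conjugate L (snd y) (fst y)")
    case (real a)
    define near where "near k n \<longleftrightarrow> (\<exists>z. Ln n z < ereal (a + inverse (Suc k) - real k * norm (z - y)))"
      for k n
    define minorized where "minorized n \<longleftrightarrow> (\<forall>z. ereal (- C - C * norm z) \<le> Ln n z)" for n
    have "\<exists>\<^sub>F n in sequentially. near k n" for k
      unfolding near_def
      by (rule frequently_near_minimisers[OF refl sd L liminf, of y a]) (simp_all add: real)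
    then have "\<exists>\<^sub>F n in sequentially. near k n \<and> minorized n" for k
      using C(2) unfolding minorized_def by (rule frequently_eventually_frequently)
    then obtain r where r: "strict_mono r" "\<And>k. near k (r k) \<and> minorized (r k)"
      using strict_mono_choice_if_frequently[of "\<lambda>k n. near k n \<and> minorized n"] by blast
    then obtain z where z: "\<And>k. Ln (r k) (z k) < ereal (a + inverse (Suc k) - real k * norm (z k - y))"
      and lb: "\<And>k. ereal (- C - C * norm (z k)) \<le> Ln (r k) (z k)"
      unfolding near_def minorized_def by metis
    define D where "D = \<bar>a\<bar> + 1 + C + C * norm y"
    have bound: "real k * norm (z k - y) \<le> D + C * norm (z k - y)" for k
    proof -
      have "ereal (- C - C * norm (z k)) < ereal (a + inverse (Suc k) - real k * norm (z k - y))"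
        using lb z by (rule order_le_less_trans)
      moreover have "C * norm (z k) \<le> C * (norm y + norm (z k - y))"
        using C(1) norm_triangle_sub[of "z k" y] by (intro mult_left_mono) auto
      moreover have "inverse (real (Suc k)) \<le> 1" by (simp add: inverse_le_1_iff)
      ultimately show ?thesis by (simp add: D_def algebra_simps)
    qed
    \<comment> \<open>For k at least 2 C, half of the penalty absorbs the linear term C * norm (z k - y).\<close>
    have "\<forall>\<^sub>F k in sequentially. norm (z k - y) \<le> 2 * D / real k"
      using eventually_ge_at_top[of "Suc (nat \<lceil>2 * C\<rceil>)"]
    proof eventually_elim
      case (elim k)
      then have k: "2 * C \<le> real k" "0 < real k" by linarith+
      have "2 * C * norm (z k - y) \<le> real k * norm (z k - y)"
        using k by (intro mult_right_mono) auto
      with bound[of k] have "real k * norm (z k - y) \<le> 2 * D" by simp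
      with k show ?case by (simp add: field_simps)
    qed
    then have "(\<lambda>k. z k - y) \<longlonglongrightarrow> 0"
      by (rule Lim_null_comparison) (rule lim_const_over_n)
    then have "weakly_converges z y"
      by (intro tendsto_imp_weakly_converges) (rule LIM_zero_cancel)
    then have "L y \<le> liminf (\<lambda>k. Ln (r k) (z k))"
      using liminf_inequality_along_subseq[of L Ln r z y] liminf r(1) by blast
    also have "\<dots> \<le> liminf (\<lambda>k. ereal (a + inverse (Suc k)))"
    proof (intro Liminf_mono always_eventually allI)
      fix k
      have "Ln (r k) (z k) \<le> ereal (a + inverse (Suc k) - real k * norm (z k - y))"
        using z by (rule less_imp_le)
      also have "\<dots> \<le> ereal (a + inverse (Suc k))" by simp
      finally show "Ln (r k) (z k) \<le> ereal (a + inverse (Suc k))" .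
    qed
    also have "(\<lambda>k. a + inverse (Suc k)) \<longlonglongrightarrow> a"
      using tendsto_add[OF tendsto_const LIMSEQ_inverse_real_of_nat] by simp
    then have "liminf (\<lambda>k. ereal (a + inverse (Suc k))) = ereal a"
      by (intro lim_imp_Liminf tendsto_ereal) auto
    finally show ?thesis by (simp add: real)
  next
    case PInf
    then show ?thesis by simp
  next
    case MInf
    have "ereal (blinfun_apply (snd y) (fst z0) + blinfun_apply (snd z0) (fst y)) - L z0
        \<le> phase_conjugate L (snd y) (fst y)"
      unfolding phase_conjugate_def by (rule SUP_upper2[of z0]) (auto simp: split_beta)
    with MInf show ?thesis by (simp add: c)
  qed
qed

lemma Mosco_limit_selfdual:
  fixes Ln :: "nat \<Rightarrow> 'a::banach phase \<Rightarrow> ereal"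
  assumes refl: "reflexive_space TYPE('a)" and sd: "\<And>n. selfdual_Lagrangian (Ln n)"
    and L: "Lagrangian L" and proper: "proper_fun L" and Mosco: "Mosco_converges Ln L"
  shows "selfdual_Lagrangian L"
proof (rule fixed_point_of_conjugation_selfdual[OF L antisym])
  fix u p
  have rec: "\<exists>y. y \<longlonglongrightarrow> z \<and> (\<lambda>n. Ln n (y n)) \<longlonglongrightarrow> L z" for z
    using Mosco unfolding Mosco_converges_def by blast
  have limsup: "\<exists>y. y \<longlonglongrightarrow> z \<and> limsup (\<lambda>n. Ln n (y n)) \<le> L z" for z
  proof -
    obtain y where y: "y \<longlonglongrightarrow> z" "(\<lambda>n. Ln n (y n)) \<longlonglongrightarrow> L z" using rec by blast
    then show ?thesis using lim_imp_Limsup[OF sequentially_bot y(2)] by (intro exI[of _ y]) simp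
  qed
  obtain y where y: "y \<longlonglongrightarrow> (u, p)" "(\<lambda>n. Ln n (y n)) \<longlonglongrightarrow> L (u, p)"
    using rec by blast
  show "phase_conjugate L p u \<le> L (u, p)"
    using conjugate_le_liminf_if_recovery[OF sd L limsup tendsto_imp_weakly_converges[OF y(1)]]
      lim_imp_Liminf[OF sequentially_bot y(2)] by simp
  show "L (u, p) \<le> phase_conjugate L p u"
    using Mosco_limit_le_conjugate[OF assms, of "(u, p)"] by simp
qed

text \<open>
  For selfdual \<open>L\<close> the conjugate in the weak liminf inequality is \<open>L\<close> itself, and this inequality turns the
  limsup bound along a recovery sequence into convergence of the values.
\<close>

lemma Mosco_if_limsup_recovery:
  fixes Ln :: "nat \<Rightarrow> 'a::banach phase \<Rightarrow> ereal"
  assumes sd: "\<And>n. selfdual_Lagrangian (Ln n)" and L: "selfdual_Lagrangian L"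
    and rec: "\<And>z. \<exists>y. y \<longlonglongrightarrow> z \<and> limsup (\<lambda>n. Ln n (y n)) \<le> L z"
  shows "Mosco_converges Ln L"
proof -
  have "Lagrangian L" and eq: "\<And>z. phase_conjugate L (snd z) (fst z) = L z"
    using L by (simp_all add: selfdual_Lagrangian_def)
  then have liminf: "L l \<le> liminf (\<lambda>n. Ln n (y n))" if "weakly_converges y l" for y l
    using conjugate_le_liminf_if_recovery[OF sd _ rec that] by simp
  have "\<exists>y. y \<longlonglongrightarrow> z \<and> (\<lambda>n. Ln n (y n)) \<longlonglongrightarrow> L z" for z
  proof -
    obtain y where y: "y \<longlonglongrightarrow> z" "limsup (\<lambda>n. Ln n (y n)) \<le> L z"
      using rec by blast
    have le: "L z \<le> liminf (\<lambda>n. Ln n (y n))"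
      using liminf[OF tendsto_imp_weakly_converges[OF y(1)]] .
    have "liminf (\<lambda>n. Ln n (y n)) \<le> limsup (\<lambda>n. Ln n (y n))"
      by (rule Liminf_le_Limsup) simp
    with le y(2) have "(\<lambda>n. Ln n (y n)) \<longlonglongrightarrow> L z"
      by (intro Liminf_eq_Limsup) auto
    with y(1) show ?thesis by blast
  qed
  with liminf show ?thesis unfolding Mosco_converges_def by blast
qed

lemma Mosco_imp_Gamma: "Mosco_converges Fn F \<Longrightarrow> Gamma_converges Fn F"
  unfolding Mosco_converges_def Gamma_converges_def
  using tendsto_imp_weakly_converges by blast

theorem theorem2p3:
  fixes Ln :: "nat \<Rightarrow> 'a::banach phase \<Rightarrow> ereal"
    and L :: "'a phase \<Rightarrow> ereal"
  assumes "reflexive_space TYPE('a)"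
    and "\<And>n. selfdual_Lagrangian (Ln n)"
    and "Lagrangian L"
    and "proper_fun L"
  shows "(Mosco_converges Ln L \<longleftrightarrow> selfdual_Lagrangian L \<and> Gamma_converges Ln L) \<and>
    (selfdual_Lagrangian L \<and> Gamma_converges Ln L \<longleftrightarrow>
       selfdual_Lagrangian L \<and>
       (\<forall>u p. \<exists>un pn. (\<lambda>n. (un n, pn n)) \<longlonglongrightarrow> (u, p) \<and>
                       limsup (\<lambda>n. Ln n (un n, pn n)) \<le> L (u, p)))"
    (is "(?Mosco \<longleftrightarrow> ?sd \<and> ?Gamma) \<and> (_ \<longleftrightarrow> _ \<and> ?rec)")
proof -
  have 12: "?sd \<and> ?Gamma" if ?Mosco
    using Mosco_limit_selfdual[OF assms that] Mosco_imp_Gamma[OF that] ..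
  have 23: ?rec if ?Gamma
  proof (intro allI)
    fix u p
    obtain y where y: "y \<longlonglongrightarrow> (u, p)" "(\<lambda>n. Ln n (y n)) \<longlonglongrightarrow> L (u, p)"
      using \<open>?Gamma\<close> unfolding Gamma_converges_def by blast
    show "\<exists>un pn. (\<lambda>n. (un n, pn n)) \<longlonglongrightarrow> (u, p) \<and> limsup (\<lambda>n. Ln n (un n, pn n)) \<le> L (u, p)"
      using y(1) lim_imp_Limsup[OF sequentially_bot y(2)]
      by (intro exI[of _ "\<lambda>n. fst (y n)"] exI[of _ "\<lambda>n. snd (y n)"]) simp
  qed
  have 31: ?Mosco if ?sd ?rec
  proof (rule Mosco_if_limsup_recovery[OF assms(2) \<open>?sd\<close>])
    fix z
    obtain un pn where "(\<lambda>n. (un n, pn n)) \<longlonglongrightarrow> (fst z, snd z)"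
      "limsup (\<lambda>n. Ln n (un n, pn n)) \<le> L (fst z, snd z)"
      using \<open>?rec\<close> by blast
    then show "\<exists>y. y \<longlonglongrightarrow> z \<and> limsup (\<lambda>n. Ln n (y n)) \<le> L z"
      by (intro exI[of _ "\<lambda>n. (un n, pn n)"]) simp
  qed
  show ?thesis using 12 23 31 by blast
qed

end
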